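(* Let $p\ge1$, let $\Xi=\Xi_1\times\cdots\times\Xi_n$ be a Polish product space with metrics $\rho_k$ on $\Xi_k$, let $Q=Q_1\otimes\cdots\otimes Q_n$ with $Q_k\in\mathcal P_p(\Xi_k)$, and let $\boldsymbol\varepsilon=(\varepsilon_1,\ldots,\varepsilon_n)$ with $\varepsilon_k>0$. Let $h_k:\Xi_k\to\mathbb R$, $k\in[n]$, be upper semicontinuous with $h_k\in L^1(Q_k)$. (a) If $h(\xi)=\sum_{k=1}^nh_k(\xi_k)$, then $$\sup_{P\in\mathcal H_p(Q,\boldsymbol\varepsilon)}\mathbb E_P[h(\xi)]=\inf_{\boldsymbol\lambda\succeq0}\sum_{k=1}^n\int_{\Xi_k}\sup_{\xi_k\in\Xi_k}\{h_k(\xi_k)+\lambda_k(\varepsilon_k^p-\rho_k(\zeta_k,\xi_k)^p)\}\,dQ_k(\zeta_k).$$ (b) If $h(\xi)=\prod_{k=1}^nh_k(\xi_k)$ and $h_k\ge0$ for all $k\in[n]$, then $$\sup_{P\in\mathcal H_p(Q,\boldsymbol\varepsilon)}\mathbb E_P[h(\xi)]=\inf_{\boldsymbol\lambda\succeq0}\prod_{k=1}^n\int_{\Xi_k}\sup_{\xi_k\in\Xi_k}\{h_k(\xi_k)+\lambda_k(\varepsilon_k^p-\rho_k(\zeta_k,\xi_k)^p)\}\,dQ_k(\zeta_k).$$ Here $\boldsymbol\lambda=(\lambda_1,\ldots,\lambda_n)\in\mathbb R^n$ and $\boldsymbol\lambda\succeq0$ means $\lambda_k\ge0$ for all $k$.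
   Context: $[n]=\{1,\ldots,n\}$. A Polish space is a complete separable metric space with its Borel $\sigma$-algebra; $\Xi$ carries the product topology. $\mathcal P_p(S)$ is the set of Borel probability measures on $S$ with finite $p$th moment. For a Polish space $(S,d)$ and $Q,P\in\mathcal P_p(S)$, $W_p(Q,P):=\big(\inf_\pi\int_{S\times S}d(\zeta,\xi)^p\,d\pi(\zeta,\xi)\big)^{1/p}$, the infimum being over probability measures on $S\times S$ with marginals $Q$ and $P$; $\mathcal B_p(Q,\varepsilon):=\{P\in\mathcal P_p(S):W_p(Q,P)\le\varepsilon\}$. The Wasserstein hyperrectangle is $\mathcal H_p(Q,\boldsymbol\varepsilon):=\{P_1\otimes\cdots\otimes P_n:P_k\in\mathcal B_p(Q_k,\varepsilon_k)\text{ for all }k\in[n]\}$ (metric $\rho_k$ on $\Xi_k$). Values may be $+\infty$. The supremum over $P$ is understood over those $P$ for which $\int h\,dP$ is well defined in $\mathbb R\cup\{-\infty,+\infty\}$ (positive or negative part of $h$ integrable); the convention $0\cdot\infty=0$ is used. The integrands $\zeta_k\mapsto\sup_{\xi_k}\{\cdots\}$ are universally measurable, and are integrated with respect to the completion of $Q_k$. *)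

theory Defs
  imports "HOL-Probability.Probability"
begin

text \<open>Spaces are bundled metrics with an explicit carrier \<open>mspace m\<close>, so that the factors of a
  product may be different spaces although their points share one HOL type.\<close>

definition polish_metric :: "'a metric \<Rightarrow> bool" where
  "polish_metric m \<longleftrightarrow> mcomplete_of m \<and> separable_space (mtopology_of m)"

definition borel_metric :: "'a metric \<Rightarrow> 'a measure" where
  "borel_metric m = sigma (mspace m) {U. openin (mtopology_of m) U}"

definition usc_on_metric :: "'a metric \<Rightarrow> ('a \<Rightarrow> real) \<Rightarrow> bool" where
  "usc_on_metric m f \<longleftrightarrow> (\<forall>t. openin (mtopology_of m) {x \<in> mspace m. f x < t})"

text \<open>By the triangle inequality, finiteness of the \<open>p\<close>th moment does not depend on the reference
  point.\<close>

definition prob_measures :: "real \<Rightarrow> 'a metric \<Rightarrow> 'a measure set" where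
  "prob_measures p m = {P. prob_space P \<and> sets P = sets (borel_metric m) \<and>
     (\<exists>x0 \<in> mspace m. (\<integral>\<^sup>+ x. ennreal (mdist m x x0 powr p) \<partial>P) < \<infinity>)}"

text \<open>On separable spaces the product \<open>\<sigma>\<close>-algebra used here (and in \<open>PiM\<close> below) is the Borel
  \<open>\<sigma>\<close>-algebra of the product topology.\<close>

definition couplings :: "'a measure \<Rightarrow> 'a measure \<Rightarrow> ('a \<times> 'a) measure set" where
  "couplings Q P = {\<pi>. prob_space \<pi> \<and> sets \<pi> = sets (Q \<Otimes>\<^sub>M P) \<and>
     distr \<pi> Q fst = Q \<and> distr \<pi> P snd = P}"

definition transport_cost :: "real \<Rightarrow> 'a metric \<Rightarrow> 'a measure \<Rightarrow> 'a measure \<Rightarrow> ennreal" where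
  "transport_cost p m Q P =
     (INF \<pi> \<in> couplings Q P. \<integral>\<^sup>+ z. ennreal (mdist m (fst z) (snd z) powr p) \<partial>\<pi>)"

text \<open>The case distinction only extends the \<open>1/p\<close>th power to \<open>\<infinity>\<close>.\<close>

definition wasserstein :: "real \<Rightarrow> 'a metric \<Rightarrow> 'a measure \<Rightarrow> 'a measure \<Rightarrow> ennreal" where
  "wasserstein p m Q P =
     (if transport_cost p m Q P = \<infinity> then \<infinity>
      else ennreal (enn2real (transport_cost p m Q P) powr (1 / p)))"

definition wasserstein_ball :: "real \<Rightarrow> 'a metric \<Rightarrow> 'a measure \<Rightarrow> real \<Rightarrow> 'a measure set" where
  "wasserstein_ball p m Q \<epsilon> = {P \<in> prob_measures p m. wasserstein p m Q P \<le> ennreal \<epsilon>}"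

definition wasserstein_hyperrectangle ::
    "nat \<Rightarrow> real \<Rightarrow> (nat \<Rightarrow> 'a metric) \<Rightarrow> (nat \<Rightarrow> 'a measure) \<Rightarrow> (nat \<Rightarrow> real)
      \<Rightarrow> (nat \<Rightarrow> 'a) measure set" where
  "wasserstein_hyperrectangle n p X Q \<epsilon> =
     {PiM {1..n} P |P. \<forall>k\<in>{1..n}. P k \<in> wasserstein_ball p (X k) (Q k) (\<epsilon> k)}"

definition integral_well_defined :: "'a measure \<Rightarrow> ('a \<Rightarrow> ereal) \<Rightarrow> bool" where
  "integral_well_defined M f \<longleftrightarrow> f \<in> borel_measurable M \<and>
     ((\<integral>\<^sup>+ x. e2ennreal (f x) \<partial>M) < \<infinity> \<or> (\<integral>\<^sup>+ x. e2ennreal (- f x) \<partial>M) < \<infinity>)"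

text \<open>Positive minus negative part (\<open>e2ennreal\<close> maps negative values to \<open>0\<close>); meaningful only under
  \<open>integral_well_defined\<close>, as \<open>\<infinity> - \<infinity>\<close> has an arbitrary value in \<open>ereal\<close>.\<close>

definition extended_integral :: "'a measure \<Rightarrow> ('a \<Rightarrow> ereal) \<Rightarrow> ereal" where
  "extended_integral M f =
     enn2ereal (\<integral>\<^sup>+ x. e2ennreal (f x) \<partial>M) - enn2ereal (\<integral>\<^sup>+ x. e2ennreal (- f x) \<partial>M)"

definition worst_case_expectation :: "'a measure set \<Rightarrow> ('a \<Rightarrow> real) \<Rightarrow> ereal" where
  "worst_case_expectation \<P> h =
     (SUP P \<in> {P \<in> \<P>. integral_well_defined P (\<lambda>x. ereal (h x))}.
        extended_integral P (\<lambda>x. ereal (h x)))"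

end

theory Submission
  imports Defs
begin

text \<open>Everything reduces to a single factor. There, the cost-value pairs \<open>(a, e)\<close> such that some
  plan with first marginal \<open>Q\<close> has transport cost at most \<open>a\<close> and expected value of \<open>h\<close> under its
  second marginal at least \<open>e\<close> form a convex subset of the plane. If no plan of cost at most
  \<open>\<epsilon> powr p\<close> has value above \<open>r\<close>, a line separates this set from a quadrant; as \<open>\<epsilon> > 0\<close>
  the line is not vertical, and its slope is a multiplier \<open>l\<close> with dual value at most \<open>r\<close>, because
  the supremum over plans of the penalised value is the integral of the pointwise supremum.

  For products of nonnegative functions, \<open>0 * \<infinity> = 0\<close> is harmless: a factor with dual infimum \<open>0\<close> has
  \<open>h = 0\<close>, and then the infimum is attained at \<open>l = 0\<close>.\<close>

subsection \<open>Extended integrals and mixtures of measures\<close>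

text \<open>The dual value may be \<open>\<infinity>\<close> for some or all multipliers, and no
  optimal multiplier, plan or coupling is assumed to exist. The argument therefore works with real
  thresholds strictly below the dual values and with couplings that are optimal up to a slack. Plans
  leave the second marginal free, so that the ball turns into a single bound on the cost, and cost
  and value are affine in the plan. Plans induced by maps already approximate the dual value, but
  mixing them leads out of that class, so convexity calls for general plans. The maps come from the
  identity by finitely many switches to constant targets, which keeps \<open>h\<close> and the cost
  integrable along them although \<open>h\<close> may be unbounded. For sums the obstacle is that
  the total may be integrable while its summands are not known to be; finite dual values control the
  positive parts, and this control passes integrability of the total on to every summand.\<close>

lemma extended_integral_completion:
  "extended_integral (completion M) f = extended_integral M f"
  by (simp add: extended_integral_def nn_integral_completion)

lemma extended_integral_ereal:
  assumes f: "integrable M f"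
  shows "extended_integral M (\<lambda>x. ereal (f x)) = ereal (integral\<^sup>L M f)"
proof -
  have fin: "(\<integral>\<^sup>+x. ennreal (f x) \<partial>M) \<noteq> \<infinity>" "(\<integral>\<^sup>+x. ennreal (- f x) \<partial>M) \<noteq> \<infinity>"
    using f by (auto dest: real_integrable_def[THEN iffD1])
  have *: "enn2ereal a - enn2ereal b = ereal (enn2real a - enn2real b)"
    if "a \<noteq> \<infinity>" "b \<noteq> \<infinity>" for a b :: ennreal
    using that by (cases a; cases b) (auto simp: enn2ereal_ennreal)
  show ?thesis
    using *[OF fin] by (simp add: extended_integral_def real_lebesgue_integral_def[OF f])
qed

text \<open>An integrable minorant excludes \<open>\<infinity> - \<infinity>\<close>: relative to
  \<open>f\<close>, the extended integral becomes a nonnegative integral, to which monotone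
  convergence and finiteness arguments apply.\<close>

lemma extended_integral_eq_add_nn_integral:
  fixes \<psi> :: "'a \<Rightarrow> ereal"
  assumes f: "integrable M f" and \<psi>[measurable]: "\<psi> \<in> borel_measurable M"
    and le: "\<And>x. x \<in> space M \<Longrightarrow> ereal (f x) \<le> \<psi> x"
  shows "extended_integral M \<psi> =
    ereal (integral\<^sup>L M f) + enn2ereal (\<integral>\<^sup>+x. e2ennreal (\<psi> x - ereal (f x)) \<partial>M)"
proof -
  note f_meas[measurable] = borel_measurable_integrable[OF f]
  have fin: "(\<integral>\<^sup>+x. ennreal (f x) \<partial>M) \<noteq> \<infinity>" "(\<integral>\<^sup>+x. ennreal (- f x) \<partial>M) \<noteq> \<infinity>"
    using f by (auto dest: real_integrable_def[THEN iffD1])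
  let ?u = "\<lambda>x. e2ennreal (\<psi> x - ereal (f x))"
  show ?thesis
  proof (cases "(\<integral>\<^sup>+x. ?u x \<partial>M) = \<infinity>")
    \<comment> \<open>The excess over \<open>f\<close> is at most the positive part of
      \<open>\<psi>\<close> plus the negative part of \<open>f\<close>. The latter has finite
      integral, so the positive part of \<open>\<psi>\<close> must have an infinite one.\<close>
    case True
    have "(\<integral>\<^sup>+x. ?u x \<partial>M) \<le> (\<integral>\<^sup>+x. e2ennreal (\<psi> x) + ennreal (- f x) \<partial>M)"
    proof (rule nn_integral_mono)
      fix x assume "x \<in> space M"
      show "?u x \<le> e2ennreal (\<psi> x) + ennreal (- f x)"
      proof (cases "\<psi> x")
        case (real r)
        have "ennreal (r - f x) \<le> ennreal (max 0 r + max 0 (- f x))"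
          by (rule ennreal_leI) auto
        also have "\<dots> = ennreal r + ennreal (- f x)"
          by (subst ennreal_plus) (auto simp: max_def ennreal_neg)
        finally show ?thesis using real by simp
      qed (use le[OF \<open>x \<in> space M\<close>] in auto)
    qed
    also have "\<dots> = (\<integral>\<^sup>+x. e2ennreal (\<psi> x) \<partial>M) + (\<integral>\<^sup>+x. ennreal (- f x) \<partial>M)"
      by (rule nn_integral_add) measurable
    finally have top: "(\<integral>\<^sup>+x. e2ennreal (\<psi> x) \<partial>M) = \<infinity>"
      using True fin by (auto simp: top_unique)
    have "(\<integral>\<^sup>+x. e2ennreal (- \<psi> x) \<partial>M) \<le> (\<integral>\<^sup>+x. ennreal (- f x) \<partial>M)"
    proof (rule nn_integral_mono)
      fix x assume "x \<in> space M"
      then have "e2ennreal (- \<psi> x) \<le> e2ennreal (- ereal (f x))"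
        using le by (intro e2ennreal_mono) (simp add: ereal_minus_le_minus del: uminus_ereal.simps)
      then show "e2ennreal (- \<psi> x) \<le> ennreal (- f x)" by simp
    qed
    then have "(\<integral>\<^sup>+x. e2ennreal (- \<psi> x) \<partial>M) \<noteq> \<infinity>"
      using fin by (auto simp: top_unique)
    then show ?thesis
      using top True by (cases "\<integral>\<^sup>+x. e2ennreal (- \<psi> x) \<partial>M") (auto simp: extended_integral_def)
  next
    case False
    let ?v = "\<lambda>x. enn2real (?u x)"
    have ae: "AE x in M. ?u x \<noteq> \<infinity>"
      using False by (intro nn_integral_PInf_AE) auto
    have eq: "(\<integral>\<^sup>+x. ?u x \<partial>M) = (\<integral>\<^sup>+x. ennreal (?v x) \<partial>M)"
      using ae by (intro nn_integral_cong_AE) (auto simp: less_top)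
    have v: "integrable M ?v"
      using False by (intro integrableI_nonneg) (auto simp: less_top eq)
    have int_v: "enn2ereal (\<integral>\<^sup>+x. ?u x \<partial>M) = ereal (integral\<^sup>L M ?v)"
      by (simp add: eq nn_integral_eq_integral[OF v] enn2ereal_ennreal)
    have ae2: "AE x in M. \<psi> x = ereal (f x + ?v x)"
      using ae AE_space
    proof eventually_elim
      case (elim x)
      with le[OF \<open>x \<in> space M\<close>] show ?case
        by (cases "\<psi> x") (auto simp: enn2real_ennreal)
    qed
    have "extended_integral M \<psi> = extended_integral M (\<lambda>x. ereal (f x + ?v x))"
      unfolding extended_integral_def
      by (intro arg_cong2[where f = minus] arg_cong[where f = enn2ereal] nn_integral_cong_AE;
          rule eventually_mono[OF ae2]; erule arg_cong arg_cong[where f = "\<lambda>x. e2ennreal (- x)"])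
    also have "\<dots> = ereal (integral\<^sup>L M f) + ereal (integral\<^sup>L M ?v)"
      using extended_integral_ereal[OF Bochner_Integration.integrable_add[OF f v]] f v by simp
    finally show ?thesis by (simp only: int_v)
  qed
qed

text \<open>The convex combination is a Bernoulli choice followed by sampling, a bind in the
  probability monad. Stating it through nonnegative integrals serves indicators, costs and both
  parts of signed functions at once.\<close>

lemma mixture_measure:
  assumes \<mu>: "prob_space \<mu>" "sets \<mu> = sets N" and \<nu>: "prob_space \<nu>" "sets \<nu> = sets N"
    and t: "0 \<le> t" "t \<le> 1"
  obtains \<kappa> where "prob_space \<kappa>" "sets \<kappa> = sets N"
    "\<And>f. f \<in> borel_measurable N \<Longrightarrow>
      (\<integral>\<^sup>+x. f x \<partial>\<kappa>) = ennreal t * (\<integral>\<^sup>+x. f x \<partial>\<mu>) + ennreal (1 - t) * (\<integral>\<^sup>+x. f x \<partial>\<nu>)"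
proof
  let ?B = "measure_pmf (bernoulli_pmf t)" and ?K = "\<lambda>b. if b then \<mu> else \<nu>"
  have K: "?K \<in> ?B \<rightarrow>\<^sub>M prob_algebra N"
    using \<mu> \<nu> by (auto simp: space_prob_algebra measurable_def)
  have B: "?B \<in> space (prob_algebra ?B)"
    by (auto simp: space_prob_algebra intro: prob_space_measure_pmf)
  show "prob_space (?B \<bind> ?K)"
    by (rule prob_space_bind'[OF B K])
  show "sets (?B \<bind> ?K) = sets N"
    by (rule sets_bind'[OF B K])
  show "(\<integral>\<^sup>+x. f x \<partial>(?B \<bind> ?K)) = ennreal t * (\<integral>\<^sup>+x. f x \<partial>\<mu>) + ennreal (1 - t) * (\<integral>\<^sup>+x. f x \<partial>\<nu>)"
    if f: "f \<in> borel_measurable N" for f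
    using nn_integral_bind[OF f measurable_prob_algebraD[OF K]] t
    by (simp add: mult.commute)
qed

lemma mixture_integrable:
  fixes f :: "'a \<Rightarrow> real"
  assumes sets: "sets \<kappa> = sets N" "sets \<mu> = sets N" "sets \<nu> = sets N"
    and mix: "\<And>f. f \<in> borel_measurable N \<Longrightarrow>
      (\<integral>\<^sup>+x. f x \<partial>\<kappa>) = ennreal t * (\<integral>\<^sup>+x. f x \<partial>\<mu>) + ennreal (1 - t) * (\<integral>\<^sup>+x. f x \<partial>\<nu>)"
    and t: "0 \<le> t" "t \<le> 1" and f: "integrable \<mu> f" "integrable \<nu> f"
  shows "integrable \<kappa> f" "integral\<^sup>L \<kappa> f = t * integral\<^sup>L \<mu> f + (1 - t) * integral\<^sup>L \<nu> f"
proof -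
  have m: "f \<in> borel_measurable N"
    using borel_measurable_integrable[OF f(1)] measurable_cong_sets[OF sets(2) refl] by blast
  then have m\<kappa>: "f \<in> borel_measurable \<kappa>"
    using measurable_cong_sets[OF sets(1) refl] by blast
  have fin: "(\<integral>\<^sup>+x. ennreal (f x) \<partial>\<mu>) < top" "(\<integral>\<^sup>+x. ennreal (- f x) \<partial>\<mu>) < top"
    "(\<integral>\<^sup>+x. ennreal (f x) \<partial>\<nu>) < top" "(\<integral>\<^sup>+x. ennreal (- f x) \<partial>\<nu>) < top"
    using f by (auto dest: real_integrable_def[THEN iffD1] simp: less_top)
  have mp: "(\<integral>\<^sup>+x. ennreal (f x) \<partial>\<kappa>) =
      ennreal t * (\<integral>\<^sup>+x. ennreal (f x) \<partial>\<mu>) + ennreal (1 - t) * (\<integral>\<^sup>+x. ennreal (f x) \<partial>\<nu>)"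
    and mn: "(\<integral>\<^sup>+x. ennreal (- f x) \<partial>\<kappa>) =
      ennreal t * (\<integral>\<^sup>+x. ennreal (- f x) \<partial>\<mu>) + ennreal (1 - t) * (\<integral>\<^sup>+x. ennreal (- f x) \<partial>\<nu>)"
    using m by (auto intro!: mix)
  show i: "integrable \<kappa> f"
    unfolding real_integrable_def using m\<kappa> fin
    by (auto simp: mp mn ennreal_mult_eq_top_iff)
  have e: "enn2real (ennreal t * a + ennreal (1 - t) * b) = t * enn2real a + (1 - t) * enn2real b"
    if "a < top" "b < top" for a b
    using that t by (subst enn2real_plus) (auto simp: enn2real_mult ennreal_mult_less_top)
  show "integral\<^sup>L \<kappa> f = t * integral\<^sup>L \<mu> f + (1 - t) * integral\<^sup>L \<nu> f"
    unfolding real_lebesgue_integral_def[OF i] real_lebesgue_integral_def[OF f(1)]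
      real_lebesgue_integral_def[OF f(2)] mp mn
    using fin by (simp add: e algebra_simps)
qed

subsection \<open>Borel sets of separable metric spaces\<close>

lemma space_borel_metric [simp]: "space (borel_metric m) = mspace m"
  by (simp add: borel_metric_def space_measure_of_conv)

lemma openin_imp_borel_metric: "openin (mtopology_of m) U \<Longrightarrow> U \<in> sets (borel_metric m)"
  using openin_subset[of "mtopology_of m"]
  by (auto simp: borel_metric_def subset_iff intro!: sets_measure_of[THEN equalityD2, THEN subsetD])

lemma continuous_map_borel_metric:
  fixes f :: "'a \<Rightarrow> real"
  assumes "continuous_map (mtopology_of m) euclideanreal f"
  shows "f \<in> borel_measurable (borel_metric m)"
proof (rule borel_measurableI)
  fix U :: "real set" assume "open U"
  then have "openin (mtopology_of m) {x \<in> topspace (mtopology_of m). f x \<in> U}"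
    using assms by (intro openin_continuous_map_preimage) auto
  moreover have "f -` U \<inter> space (borel_metric m) = {x \<in> topspace (mtopology_of m). f x \<in> U}"
    by auto
  ultimately show "f -` U \<inter> space (borel_metric m) \<in> sets (borel_metric m)"
    by (simp add: openin_imp_borel_metric)
qed

lemma separable_metric_dense:
  assumes "separable_space (mtopology_of m)"
  obtains D where "countable D" "D \<subseteq> mspace m"
    "\<And>x r. x \<in> mspace m \<Longrightarrow> 0 < r \<Longrightarrow> \<exists>y\<in>D. mdist m x y < r"
proof -
  interpret Metric_space "mspace m" "mdist m" by simp
  from assms obtain D where D: "countable D" "D \<subseteq> mspace m" "mtopology closure_of D = mspace m"
    by (auto simp: separable_space_def mtopology_of_def)
  show thesis
  proof
    show "\<exists>y\<in>D. mdist m x y < r" if "x \<in> mspace m" "0 < r" for x r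
      using that D(3) unfolding metric_closure_of by force
  qed (use D in auto)
qed

text \<open>Separability brings the distance into the product sigma-algebra: it is below
  \<open>r\<close> iff some detour through a point of the countable dense set is shorter than
  \<open>r\<close>.\<close>

lemma measurable_mdist_pair:
  assumes sep: "separable_space (mtopology_of m)"
  shows "(\<lambda>z. mdist m (fst z) (snd z)) \<in> borel_measurable (borel_metric m \<Otimes>\<^sub>M borel_metric m)"
proof -
  obtain D where D: "countable D" "D \<subseteq> mspace m"
    "\<And>x r. x \<in> mspace m \<Longrightarrow> 0 < r \<Longrightarrow> \<exists>y\<in>D. mdist m x y < r"
    using separable_metric_dense[OF sep] by blast
  have [measurable]: "(\<lambda>x. mdist m s x) \<in> borel_measurable (borel_metric m)" if "s \<in> D" for s
    using that D by (intro continuous_map_borel_metric continuous_map_mdist continuous_intros) auto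
  let ?N = "borel_metric m \<Otimes>\<^sub>M borel_metric m"
  show ?thesis
  proof (rule borel_measurableI_less)
    fix r :: real
    have "{z \<in> space ?N. mdist m (fst z) (snd z) < r} =
      (\<Union>s\<in>D. {z \<in> space ?N. mdist m s (fst z) + mdist m s (snd z) < r})" (is "?L = ?R")
    proof (intro equalityI subsetI)
      fix z assume z: "z \<in> ?L"
      \<comment> \<open>Half the slack, because the detour through \<open>s\<close> adds at most
        twice the distance from \<open>fst z\<close> to \<open>s\<close>.\<close>
      define e where "e = (r - mdist m (fst z) (snd z)) / 2"
      obtain s where s: "s \<in> D" "mdist m (fst z) s < e"
        using D(3)[of "fst z" e] z by (auto simp: e_def space_pair_measure)
      have "mdist m s (snd z) \<le> mdist m s (fst z) + mdist m (fst z) (snd z)"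
        using z s D by (intro mdist_triangle) (auto simp: space_pair_measure)
      then have "mdist m s (fst z) + mdist m s (snd z) < r"
        using s(2) by (simp add: e_def mdist_commute[of m "fst z" s] field_simps)
      then show "z \<in> ?R" using z s by auto
    next
      fix z assume "z \<in> ?R"
      then obtain s where s: "s \<in> D" "z \<in> space ?N" "mdist m s (fst z) + mdist m s (snd z) < r"
        by auto
      have "mdist m (fst z) (snd z) \<le> mdist m (fst z) s + mdist m s (snd z)"
        using s D by (intro mdist_triangle) (auto simp: space_pair_measure)
      then show "z \<in> ?L" using s by (simp add: mdist_commute[of m "fst z" s])
    qed
    also have "\<dots> \<in> sets ?N"
      using D(1) by (intro sets.countable_UN') (auto, measurable)
    finally show "{z \<in> space ?N. mdist m (fst z) (snd z) < r} \<in> sets ?N" .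
  qed
qed

text \<open>An uncountable supremum of lower semicontinuous functions is that of a countable
  subfamily, which makes near-maximisers measurably selectable without a selection theorem.\<close>

lemma countable_subfamily_same_sup:
  fixes f :: "'i \<Rightarrow> 'a \<Rightarrow> real"
  assumes sep: "separable_space (mtopology_of m)"
    and op: "\<And>i t. i \<in> I \<Longrightarrow> openin (mtopology_of m) {x \<in> mspace m. t < f i x}"
  obtains C where "countable C" "C \<subseteq> I"
    "\<forall>x\<in>mspace m. \<forall>i\<in>I. \<forall>t<f i x. \<exists>j\<in>C. t < f j x"
proof -
  interpret Metric_space "mspace m" "mdist m" by simp
  obtain D where D: "countable D" "D \<subseteq> mspace m"
    "\<And>x r. x \<in> mspace m \<Longrightarrow> 0 < r \<Longrightarrow> \<exists>y\<in>D. mdist m x y < r"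
    using separable_metric_dense[OF sep] by blast
  \<comment> \<open>Lindelof argument: where \<open>f i\<close> exceeds a rational \<open>t\<close>,
    it does so on a ball of radius \<open>1 / Suc n\<close> about a point of \<open>D\<close>. There
    are countably many such triples, and one index is picked for each triple that admits
    any.\<close>
  define good where "good = (\<lambda>(s, n, t) i. i \<in> I \<and> (\<forall>z\<in>mball s (1 / Suc n). t < f i z))"
  define T where "T = {u \<in> D \<times> (UNIV :: nat set) \<times> \<rat>. \<exists>i. good u i}"
  define pick where "pick = (\<lambda>u. SOME i. good u i)"
  have pick: "good u (pick u)" if "u \<in> T" for u
    using that unfolding pick_def T_def by (auto intro: someI)
  show thesis
  proof
    have "countable (D \<times> (UNIV :: nat set) \<times> (\<rat> :: real set))"
      using D(1) countable_rat by auto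
    then show "countable (pick ` T)"
      by (auto simp: T_def intro: countable_subset)
    show "pick ` T \<subseteq> I"
      using pick by (fastforce simp: good_def split: prod.splits)
    show "\<forall>x\<in>mspace m. \<forall>i\<in>I. \<forall>t<f i x. \<exists>j\<in>pick ` T. t < f j x"
    proof (intro ballI allI impI)
      fix x i t assume x: "x \<in> mspace m" and i: "i \<in> I" and t: "t < f i x"
      obtain t' where t': "t' \<in> \<rat>" "t < t'" "t' < f i x"
        using Rats_dense_in_real[OF t] by auto
      have "openin mtopology {x \<in> mspace m. t' < f i x}"
        using op[OF i] by (simp add: mtopology_of_def)
      with x t' obtain r where r: "0 < r" "mball x r \<subseteq> {x \<in> mspace m. t' < f i x}"
        unfolding openin_mtopology by blast
      \<comment> \<open>Half of \<open>r\<close>, so that the ball about \<open>s\<close>, which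
        contains \<open>x\<close>, stays inside \<open>mball x r\<close>.\<close>
      obtain n where n: "1 / Suc n < r / 2"
        using reals_Archimedean[of "r / 2"] r by (auto simp: inverse_eq_divide)
      obtain s where s: "s \<in> D" "mdist m x s < 1 / Suc n"
        using D(3)[OF x, of "1 / Suc n"] by auto
      have sm: "s \<in> mspace m" using s D by auto
      have "mball s (1 / Suc n) \<subseteq> mball x r"
      proof
        fix z assume z: "z \<in> mball s (1 / Suc n)"
        then have "mdist m x z \<le> mdist m x s + mdist m s z"
          using x sm by (intro mdist_triangle) auto
        also have "\<dots> < r" using z s n by auto
        finally show "z \<in> mball x r" using x z by auto
      qed
      then have "good (s, n, t') i" using r i by (auto simp: good_def)
      then have u: "(s, n, t') \<in> T" using s t' by (auto simp: T_def)
      have "x \<in> mball s (1 / Suc n)" using x sm s by (simp add: mdist_commute)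
      then have "t' < f (pick (s, n, t')) x"
        using pick[OF u] by (auto simp: good_def)
      then show "\<exists>j\<in>pick ` T. t < f j x" using u t' by (auto intro!: bexI[of _ "(s, n, t')"])
    qed
  qed
qed

subsection \<open>Duality for one factor\<close>

text \<open>The crude constant comes from bounding a sum by twice the maximum; it is only used to
  show that moments are finite.\<close>

lemma powr_mdist_triangle:
  assumes "1 \<le> p" "x \<in> mspace m" "y \<in> mspace m" "z \<in> mspace m"
  shows "mdist m x z powr p \<le> 2 powr p * (mdist m x y powr p + mdist m y z powr p)"
proof -
  let ?a = "mdist m x y" and ?b = "mdist m y z"
  have "mdist m x z \<le> 2 * max ?a ?b"
    using mdist_triangle[of x m y z] assms by auto
  then have "mdist m x z powr p \<le> (2 * max ?a ?b) powr p"
    using assms by (intro powr_mono2) auto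
  also have "\<dots> = 2 powr p * max ?a ?b powr p"
    by (simp add: powr_mult)
  also have "\<dots> \<le> 2 powr p * (?a powr p + ?b powr p)"
    by (intro mult_left_mono) (auto simp: max_def)
  finally show ?thesis .
qed

locale wasserstein_duality =
  fixes X :: "'a metric" and p \<epsilon> :: real and Q :: "'a measure" and h :: "'a \<Rightarrow> real"
  assumes separable: "separable_space (mtopology_of X)"
    and p_ge_1: "1 \<le> p" and eps_pos: "0 < \<epsilon>"
    and Q: "Q \<in> prob_measures p X"
    and h_integrable: "integrable Q h"
begin

abbreviation M :: "'a measure" where "M \<equiv> borel_metric X"

definition c :: "'a \<Rightarrow> 'a \<Rightarrow> real" where "c \<zeta> \<xi> = mdist X \<zeta> \<xi> powr p"

text \<open>Lagrangian integrand: \<open>l\<close> is the price of transport cost, and unspent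
  budget is credited at the same price.\<close>

definition gain :: "real \<Rightarrow> 'a \<Rightarrow> 'a \<Rightarrow> real" where
  "gain l \<zeta> \<xi> = h \<xi> + l * (\<epsilon> powr p - c \<zeta> \<xi>)"

definition \<psi> :: "real \<Rightarrow> 'a \<Rightarrow> ereal" where
  "\<psi> l \<zeta> = (SUP \<xi> \<in> mspace X. ereal (gain l \<zeta> \<xi>))"

definition dual :: "real \<Rightarrow> ereal" where
  "dual l = extended_integral (completion Q) (\<psi> l)"

text \<open>Couplings of \<open>Q\<close> with an unspecified partner. Since the only marginal
  constraint is linear, mixtures stay inside.\<close>

definition plans :: "('a \<times> 'a) measure set" where
  "plans = {\<pi>. prob_space \<pi> \<and> sets \<pi> = sets (M \<Otimes>\<^sub>M M) \<and> distr \<pi> Q fst = Q}"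

lemma prob_space_Q: "prob_space Q" and sets_Q: "sets Q = sets M"
  using Q by (auto simp: prob_measures_def)

lemma space_Q [simp]: "space Q = mspace X"
  using sets_eq_imp_space_eq[OF sets_Q] by simp

lemma h_measurable [measurable]: "h \<in> borel_measurable M"
  using borel_measurable_integrable[OF h_integrable] measurable_cong_sets[OF sets_Q refl] by blast

lemma c_nonneg [simp]: "0 \<le> c x y" and c_same [simp]: "x \<in> mspace X \<Longrightarrow> c x x = 0"
  by (auto simp: c_def)

lemma c_measurable [measurable]: "(\<lambda>z. c (fst z) (snd z)) \<in> borel_measurable (M \<Otimes>\<^sub>M M)"
  using measurable_mdist_pair[OF separable] unfolding c_def by measurable

lemma c_measurable1:
  assumes "f \<in> N \<rightarrow>\<^sub>M M" "g \<in> N \<rightarrow>\<^sub>M M"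
  shows "(\<lambda>x. c (f x) (g x)) \<in> borel_measurable N"
  using measurable_compose[OF measurable_Pair[OF assms] c_measurable] by simp

lemma measurable_Q: "measurable Q N = measurable M N"
  by (rule measurable_cong_sets[OF sets_Q refl])

text \<open>The moment condition supplies one reference point \<open>y\<close> only; the relaxed
  triangle inequality carries it over to \<open>x\<close>.\<close>

lemma c_integrable:
  assumes x: "x \<in> mspace X"
  shows "integrable Q (\<lambda>\<zeta>. c \<zeta> x)"
proof -
  interpret prob_space Q by (rule prob_space_Q)
  obtain y where y: "y \<in> mspace X" "(\<integral>\<^sup>+ \<zeta>. ennreal (c \<zeta> y) \<partial>Q) < \<infinity>"
    using Q by (auto simp: prob_measures_def c_def)
  have cm: "(\<lambda>\<zeta>. c \<zeta> z) \<in> borel_measurable Q" if "z \<in> mspace X" for z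
    unfolding measurable_Q using that by (intro c_measurable1) auto
  have "integrable Q (\<lambda>\<zeta>. c \<zeta> y)"
    using y cm by (intro integrableI_nonneg) auto
  then have "integrable Q (\<lambda>\<zeta>. 2 powr p * (c \<zeta> y + c y x))"
    by auto
  then show ?thesis
  proof (rule Bochner_Integration.integrable_bound)
    show "AE \<zeta> in Q. norm (c \<zeta> x) \<le> norm (2 powr p * (c \<zeta> y + c y x))"
      using x y powr_mdist_triangle[OF p_ge_1, of _ X y x] by (intro AE_I2) (simp add: c_def)
  qed (use x cm in auto)
qed

section \<open>Measurability of the pointwise supremum\<close>

lemma gain_measurable:
  assumes "T \<in> M \<rightarrow>\<^sub>M M"
  shows "(\<lambda>\<zeta>. gain l \<zeta> (T \<zeta>)) \<in> borel_measurable M"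
proof -
  note assms[measurable]
  have [measurable]: "(\<lambda>\<zeta>. c \<zeta> (T \<zeta>)) \<in> borel_measurable M"
    using assms by (intro c_measurable1) auto
  show ?thesis unfolding gain_def by measurable
qed

lemma gain_le_psi: "\<xi> \<in> mspace X \<Longrightarrow> ereal (gain l \<zeta> \<xi>) \<le> \<psi> l \<zeta>"
  unfolding \<psi>_def by (rule SUP_upper)

lemma openin_gain:
  assumes "\<xi> \<in> mspace X"
  shows "openin (mtopology_of X) {\<zeta> \<in> mspace X. t < gain l \<zeta> \<xi>}"
proof -
  have 1: "continuous_map (mtopology_of X) euclideanreal (\<lambda>\<zeta>. mdist X \<zeta> \<xi>)"
    using assms by (intro continuous_map_mdist) auto
  \<comment> \<open>The absolute value changes nothing at distances, but keeps the base of the power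
    nonnegative on the whole line.\<close>
  have "continuous_on UNIV (\<lambda>x::real. h \<xi> + l * (\<epsilon> powr p - \<bar>x\<bar> powr p))"
    using p_ge_1 by (intro continuous_intros continuous_on_powr') auto
  then have "continuous_map euclideanreal euclideanreal (\<lambda>x::real. h \<xi> + l * (\<epsilon> powr p - \<bar>x\<bar> powr p))"
    by simp
  from continuous_map_compose[OF 1 this]
  have "continuous_map (mtopology_of X) euclideanreal (\<lambda>\<zeta>. gain l \<zeta> \<xi>)"
    by (simp add: o_def gain_def c_def)
  then have "openin (mtopology_of X) {\<zeta> \<in> topspace (mtopology_of X). gain l \<zeta> \<xi> \<in> {t<..}}"
    by (rule openin_continuous_map_preimage) auto
  then show ?thesis by simp
qed

text \<open>For a fixed target \<open>\<xi>\<close> the number \<open>h \<xi>\<close> is a constant,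
  so the gain is continuous in the starting point. The targets thus index a family of lower
  semicontinuous functions, and a countable subfamily suffices.\<close>

lemma psi_eq_countable_SUP:
  obtains \<xi> :: "nat \<Rightarrow> 'a" where "range \<xi> \<subseteq> mspace X"
    "\<forall>\<zeta>\<in>mspace X. \<psi> l \<zeta> = (SUP i. ereal (gain l \<zeta> (\<xi> i)))"
proof -
  obtain C where C: "countable C" "C \<subseteq> mspace X"
    "\<forall>\<zeta>\<in>mspace X. \<forall>\<xi>\<in>mspace X. \<forall>t<gain l \<zeta> \<xi>. \<exists>j\<in>C. t < gain l \<zeta> j"
    by (rule countable_subfamily_same_sup[OF separable, of "mspace X" "\<lambda>\<xi> \<zeta>. gain l \<zeta> \<xi>"])
      (rule openin_gain)
  interpret prob_space Q by (rule prob_space_Q)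
  obtain x0 where x0: "x0 \<in> mspace X" using not_empty by auto
  \<comment> \<open>Any threshold below \<open>gain l x0 x0\<close> must be exceeded by a member of
    \<open>C\<close>; nonemptiness lets \<open>from_nat_into\<close> enumerate
    \<open>C\<close>.\<close>
  have "C \<noteq> {}" using C(3) x0 lt_ex[of "gain l x0 x0"] by blast
  show thesis
  proof
    have mem: "from_nat_into C i \<in> mspace X" for i
      using from_nat_into[OF \<open>C \<noteq> {}\<close>, of i] C by auto
    then show "range (from_nat_into C) \<subseteq> mspace X" by auto
    show "\<forall>\<zeta>\<in>mspace X. \<psi> l \<zeta> = (SUP i. ereal (gain l \<zeta> (from_nat_into C i)))"
    proof
      fix \<zeta> assume \<zeta>: "\<zeta> \<in> mspace X"
      have "\<psi> l \<zeta> \<le> (SUP \<xi>\<in>C. ereal (gain l \<zeta> \<xi>))"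
        unfolding \<psi>_def
      proof (rule SUP_least)
        fix \<xi> assume \<xi>: "\<xi> \<in> mspace X"
        show "ereal (gain l \<zeta> \<xi>) \<le> (SUP \<xi>\<in>C. ereal (gain l \<zeta> \<xi>))"
        proof (rule dense_le)
          fix y assume y: "y < ereal (gain l \<zeta> \<xi>)"
          show "y \<le> (SUP \<xi>\<in>C. ereal (gain l \<zeta> \<xi>))"
          proof (cases y)
            case (real t)
            then obtain j where "j \<in> C" "t < gain l \<zeta> j" using C(3) \<zeta> \<xi> y by fastforce
            then show ?thesis using real by (intro SUP_upper2[of j]) auto
          qed (use y in auto)
        qed
      qed
      moreover have "(SUP \<xi>\<in>C. ereal (gain l \<zeta> \<xi>)) = (SUP i. ereal (gain l \<zeta> (from_nat_into C i)))"
        using range_from_nat_into[OF \<open>C \<noteq> {}\<close> C(1)]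
          image_image[of "\<lambda>\<xi>. ereal (gain l \<zeta> \<xi>)" "from_nat_into C" UNIV] by simp
      moreover have "(SUP i. ereal (gain l \<zeta> (from_nat_into C i))) \<le> \<psi> l \<zeta>"
        using mem by (intro SUP_least gain_le_psi) auto
      ultimately show "\<psi> l \<zeta> = (SUP i. ereal (gain l \<zeta> (from_nat_into C i)))" by simp
    qed
  qed
qed

lemma psi_measurable: "\<psi> l \<in> borel_measurable Q"
proof -
  obtain \<xi> :: "nat \<Rightarrow> 'a" where \<xi>': "range \<xi> \<subseteq> mspace X"
    "\<forall>\<zeta>\<in>mspace X. \<psi> l \<zeta> = (SUP i. ereal (gain l \<zeta> (\<xi> i)))"
    by (rule psi_eq_countable_SUP[of l])
  have \<xi>: "\<xi> i \<in> mspace X"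
    "\<zeta> \<in> mspace X \<Longrightarrow> \<psi> l \<zeta> = (SUP i. ereal (gain l \<zeta> (\<xi> i)))" for i \<zeta>
    using \<xi>' by auto
  have [measurable]: "(\<lambda>\<zeta>. gain l \<zeta> (\<xi> i)) \<in> borel_measurable M" for i
    using \<xi>(1) by (intro gain_measurable) auto
  have "(\<lambda>\<zeta>. SUP i. ereal (gain l \<zeta> (\<xi> i))) \<in> borel_measurable M"
    by measurable
  then show ?thesis unfolding measurable_Q using \<xi>(2) by (subst measurable_cong) auto
qed

section \<open>The dual value and its lower bounds\<close>

lemma dual_eq:
  assumes f: "integrable Q f" and le: "\<And>\<zeta>. \<zeta> \<in> mspace X \<Longrightarrow> ereal (f \<zeta>) \<le> \<psi> l \<zeta>"
  shows "dual l = ereal (integral\<^sup>L Q f) + enn2ereal (\<integral>\<^sup>+\<zeta>. e2ennreal (\<psi> l \<zeta> - ereal (f \<zeta>)) \<partial>Q)"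
  unfolding dual_def extended_integral_completion
  using assms by (intro extended_integral_eq_add_nn_integral psi_measurable) auto

lemma dual_ge:
  assumes f: "integrable Q f" and le: "\<And>\<zeta>. \<zeta> \<in> mspace X \<Longrightarrow> ereal (f \<zeta>) \<le> \<psi> l \<zeta>"
  shows "ereal (integral\<^sup>L Q f) \<le> dual l"
proof -
  have "ereal a \<le> ereal a + enn2ereal b" for a b
    using add_left_mono[OF enn2ereal_nonneg, of "ereal a" b] by simp
  then show ?thesis using dual_eq[OF assms] by simp
qed

lemma gain_self: "\<zeta> \<in> mspace X \<Longrightarrow> gain l \<zeta> \<zeta> = h \<zeta> + l * \<epsilon> powr p"
  by (simp add: gain_def)

lemma gain_self_integrable:
  "integrable Q (\<lambda>\<zeta>. h \<zeta> + l * \<epsilon> powr p)"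
  "(\<integral>\<zeta>. h \<zeta> + l * \<epsilon> powr p \<partial>Q) = (\<integral>\<zeta>. h \<zeta> \<partial>Q) + l * \<epsilon> powr p"
proof -
  interpret prob_space Q by (rule prob_space_Q)
  show "integrable Q (\<lambda>\<zeta>. h \<zeta> + l * \<epsilon> powr p)"
    "(\<integral>\<zeta>. h \<zeta> + l * \<epsilon> powr p \<partial>Q) = (\<integral>\<zeta>. h \<zeta> \<partial>Q) + l * \<epsilon> powr p"
    using h_integrable prob_space by auto
qed

lemma gain_self_le_psi: "\<zeta> \<in> mspace X \<Longrightarrow> ereal (h \<zeta> + l * \<epsilon> powr p) \<le> \<psi> l \<zeta>"
  using gain_le_psi[of \<zeta> l \<zeta>] gain_self by simp

text \<open>Leaving all mass in place costs nothing and is credited with the full budget. Hence the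
  dual value is never \<open>-\<infinity>\<close> and grows at least linearly in
  \<open>l\<close>.\<close>

lemma dual_ge_self: "ereal ((\<integral>\<zeta>. h \<zeta> \<partial>Q) + l * \<epsilon> powr p) \<le> dual l"
  using dual_ge[OF gain_self_integrable(1) gain_self_le_psi] gain_self_integrable(2) by simp

text \<open>Bound obtained by sending all mass to the single point \<open>x\<close>.\<close>

lemma dual_ge_const:
  assumes x: "x \<in> mspace X"
  shows "ereal (h x + l * (\<epsilon> powr p - (\<integral>\<zeta>. c \<zeta> x \<partial>Q))) \<le> dual l"
proof -
  interpret prob_space Q by (rule prob_space_Q)
  have "ereal (\<integral>\<zeta>. gain l \<zeta> x \<partial>Q) \<le> dual l"
    using c_integrable[OF x] gain_le_psi[OF x] by (intro dual_ge) (auto simp: gain_def)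
  also have "(\<integral>\<zeta>. gain l \<zeta> x \<partial>Q) = h x + l * (\<epsilon> powr p - (\<integral>\<zeta>. c \<zeta> x \<partial>Q))"
    using c_integrable[OF x] prob_space by (simp add: gain_def)
  finally show ?thesis .
qed

section \<open>Transport maps that nearly attain the dual value\<close>

text \<open>The gains along greedily improved maps increase to \<open>\<psi> l\<close>, and monotone
  convergence moves this under the integral. The argument also covers an infinite dual
  value.\<close>

lemma near_optimal_map:
  assumes s: "ereal s < dual l"
  obtains T where "T \<in> M \<rightarrow>\<^sub>M M" "integrable Q (\<lambda>\<zeta>. h (T \<zeta>))" "integrable Q (\<lambda>\<zeta>. c \<zeta> (T \<zeta>))"
    "s < (\<integral>\<zeta>. gain l \<zeta> (T \<zeta>) \<partial>Q)"
proof -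
  interpret prob_space Q by (rule prob_space_Q)
  obtain \<xi> :: "nat \<Rightarrow> 'a" where \<xi>': "range \<xi> \<subseteq> mspace X"
    "\<forall>\<zeta>\<in>mspace X. \<psi> l \<zeta> = (SUP i. ereal (gain l \<zeta> (\<xi> i)))"
    by (rule psi_eq_countable_SUP[of l])
  have \<xi>: "\<xi> i \<in> mspace X"
    "\<zeta> \<in> mspace X \<Longrightarrow> \<psi> l \<zeta> = (SUP i. ereal (gain l \<zeta> (\<xi> i)))" for i \<zeta>
    using \<xi>' by auto
  \<comment> \<open>Greedy choice: start at the identity and move to the next constant target only
    where this strictly raises the gain. Thus \<open>T m\<close> attains the maximum of the gains of
    staying put and of the targets \<open>\<xi> i\<close> with \<open>i < m\<close>.\<close>
  define T where "T = rec_nat (\<lambda>\<zeta>. \<zeta>) (\<lambda>m t \<zeta>. if gain l \<zeta> (t \<zeta>) < gain l \<zeta> (\<xi> m) then \<xi> m else t \<zeta>)"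
  have T0: "T 0 = (\<lambda>\<zeta>. \<zeta>)" by (simp add: T_def)
  have TS: "T (Suc m) \<zeta> = (if gain l \<zeta> (T m \<zeta>) < gain l \<zeta> (\<xi> m) then \<xi> m else T m \<zeta>)" for m \<zeta>
    by (simp add: T_def)
  let ?g = "\<lambda>m \<zeta>. gain l \<zeta> (T m \<zeta>)"
  have T_meas: "T m \<in> M \<rightarrow>\<^sub>M M" for m
  proof (induction m)
    case (Suc m)
    have [measurable]: "?g m \<in> borel_measurable M" "(\<lambda>\<zeta>. gain l \<zeta> (\<xi> m)) \<in> borel_measurable M"
      using Suc \<xi>(1) by (auto intro!: gain_measurable)
    have "{\<zeta> \<in> space M. ?g m \<zeta> < gain l \<zeta> (\<xi> m)} \<in> sets M"
      by measurable
    then have "(\<lambda>\<zeta>. if gain l \<zeta> (T m \<zeta>) < gain l \<zeta> (\<xi> m) then \<xi> m else T m \<zeta>) \<in> M \<rightarrow>\<^sub>M M"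
      using Suc \<xi>(1) by (intro measurable_If) simp_all
    then show ?case by (simp add: TS[abs_def])
  qed (simp add: T0)
  have T_mem: "T m \<zeta> \<in> mspace X" if "\<zeta> \<in> mspace X" for m \<zeta>
    using measurable_space[OF T_meas, of \<zeta> m] that by simp
  have T_int: "integrable Q (\<lambda>\<zeta>. h (T m \<zeta>)) \<and> integrable Q (\<lambda>\<zeta>. c \<zeta> (T m \<zeta>))" for m
  proof (induction m)
    case 0
    have "integrable Q (\<lambda>\<zeta>. c \<zeta> \<zeta>) \<longleftrightarrow> integrable Q (\<lambda>\<zeta>. 0 :: real)"
      by (intro Bochner_Integration.integrable_cong) auto
    then show ?case using h_integrable by (simp add: T0)
  next
    case (Suc m)
    note T_meas[of "Suc m", measurable]
    have [measurable]: "(\<lambda>\<zeta>. c \<zeta> (T (Suc m) \<zeta>)) \<in> borel_measurable M"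
      using T_meas by (intro c_measurable1) auto
    \<comment> \<open>Pointwise \<open>T (Suc m)\<close> is either \<open>T m\<close> or a constant,
      so the sum of the two absolute values dominates.\<close>
    have "integrable Q (\<lambda>\<zeta>. h (T (Suc m) \<zeta>))"
    proof (rule Bochner_Integration.integrable_bound)
      show "integrable Q (\<lambda>\<zeta>. \<bar>h (\<xi> m)\<bar> + \<bar>h (T m \<zeta>)\<bar>)" using Suc by simp
    qed (unfold measurable_Q, measurable, auto simp: TS)
    moreover have "integrable Q (\<lambda>\<zeta>. c \<zeta> (T (Suc m) \<zeta>))"
    proof (rule Bochner_Integration.integrable_bound)
      show "integrable Q (\<lambda>\<zeta>. c \<zeta> (\<xi> m) + c \<zeta> (T m \<zeta>))" using Suc c_integrable[OF \<xi>(1)] by simp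
    qed (unfold measurable_Q, measurable, auto simp: TS)
    ultimately show ?case by blast
  qed
  have g_int: "integrable Q (?g m)" for m
    using T_int[of m] by (auto simp: gain_def)
  have g_mono: "incseq (\<lambda>m. ?g m \<zeta>)" for \<zeta>
    by (intro incseq_SucI) (simp add: TS)
  show thesis
  proof (rule ccontr)
    assume "\<not> thesis"
    then have bnd: "integral\<^sup>L Q (?g m) \<le> s" for m
      using that[OF T_meas[of m] conjunct1[OF T_int] conjunct2[OF T_int]] by (meson not_le)
    \<comment> \<open>Measuring gains from the integrable \<open>?g 0\<close> makes the increasing
      sequence nonnegative, as monotone convergence for \<open>ennreal\<close> requires.\<close>
    have "(\<integral>\<^sup>+\<zeta>. e2ennreal (\<psi> l \<zeta> - ereal (?g 0 \<zeta>)) \<partial>Q) \<le> (\<integral>\<^sup>+\<zeta>. (SUP m. ennreal (?g m \<zeta> - ?g 0 \<zeta>)) \<partial>Q)"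
    proof (rule nn_integral_mono)
      fix \<zeta> assume "\<zeta> \<in> space Q"
      then have \<zeta>: "\<zeta> \<in> mspace X" by simp
      show "e2ennreal (\<psi> l \<zeta> - ereal (?g 0 \<zeta>)) \<le> (SUP m. ennreal (?g m \<zeta> - ?g 0 \<zeta>))" (is "_ \<le> ?S")
      proof (cases ?S)
        case (real r)
        have "?g m \<zeta> - ?g 0 \<zeta> \<le> r" for m
        proof -
          have "ennreal (?g m \<zeta> - ?g 0 \<zeta>) \<le> ennreal r"
            unfolding real(2)[symmetric] by (rule SUP_upper) simp
          then show ?thesis using real(1) by (simp add: ennreal_le_iff)
        qed
        \<comment> \<open>Target \<open>\<xi> i\<close> is examined on passing from
          \<open>T i\<close> to \<open>T (Suc i)\<close>, hence the shift of the index.\<close>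
        moreover have "gain l \<zeta> (\<xi> i) \<le> ?g (Suc i) \<zeta>" for i by (simp add: TS)
        ultimately have "gain l \<zeta> (\<xi> i) \<le> r + ?g 0 \<zeta>" for i
          by (meson diff_le_eq order_trans)
        then have "\<psi> l \<zeta> \<le> ereal (r + ?g 0 \<zeta>)"
          unfolding \<xi>(2)[OF \<zeta>] by (intro SUP_least) auto
        then have "\<psi> l \<zeta> - ereal (?g 0 \<zeta>) \<le> ereal r"
          by (cases "\<psi> l \<zeta>") auto
        then show ?thesis
          unfolding real(2) by (metis e2ennreal_ereal e2ennreal_mono)
      next
        case top
        show ?thesis unfolding top by simp
      qed
    qed
    also have "\<dots> = (SUP m. (\<integral>\<^sup>+\<zeta>. ennreal (?g m \<zeta> - ?g 0 \<zeta>) \<partial>Q))"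
    proof (rule nn_integral_monotone_convergence_SUP)
      show "incseq (\<lambda>m \<zeta>. ennreal (?g m \<zeta> - ?g 0 \<zeta>))"
        unfolding incseq_def le_fun_def
        by (intro allI impI ennreal_leI diff_right_mono incseqD[OF g_mono])
      show "(\<lambda>\<zeta>. ennreal (?g m \<zeta> - ?g 0 \<zeta>)) \<in> borel_measurable Q" for m
        using borel_measurable_integrable[OF g_int[of m]] borel_measurable_integrable[OF g_int[of 0]]
        by measurable
    qed
    also have "\<dots> \<le> ennreal (s - integral\<^sup>L Q (?g 0))"
    proof (rule SUP_least)
      fix m
      have "(\<integral>\<^sup>+\<zeta>. ennreal (?g m \<zeta> - ?g 0 \<zeta>) \<partial>Q) = ennreal (\<integral>\<zeta>. ?g m \<zeta> - ?g 0 \<zeta> \<partial>Q)"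
        using incseqD[OF g_mono, of 0 m] g_int[of m] g_int[of 0]
        by (intro nn_integral_eq_integral Bochner_Integration.integrable_diff AE_I2) simp_all
      also have "\<dots> = ennreal (integral\<^sup>L Q (?g m) - integral\<^sup>L Q (?g 0))"
        using g_int by simp
      also have "\<dots> \<le> ennreal (s - integral\<^sup>L Q (?g 0))"
        using bnd by (intro ennreal_leI) auto
      finally show "(\<integral>\<^sup>+\<zeta>. ennreal (?g m \<zeta> - ?g 0 \<zeta>) \<partial>Q) \<le> ennreal (s - integral\<^sup>L Q (?g 0))" .
    qed
    finally have "enn2ereal (\<integral>\<^sup>+\<zeta>. e2ennreal (\<psi> l \<zeta> - ereal (?g 0 \<zeta>)) \<partial>Q) \<le> enn2ereal (ennreal (s - integral\<^sup>L Q (?g 0)))"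
      by (simp add: less_eq_ennreal.rep_eq)
    \<comment> \<open>The assumed bound at \<open>m = 0\<close> makes this difference nonnegative,
      so \<open>ennreal\<close> does not truncate it.\<close>
    also have "\<dots> = ereal (s - integral\<^sup>L Q (?g 0))"
      using bnd[of 0] by (simp add: enn2ereal_ennreal)
    finally have "ereal (integral\<^sup>L Q (?g 0)) + enn2ereal (\<integral>\<^sup>+\<zeta>. e2ennreal (\<psi> l \<zeta> - ereal (?g 0 \<zeta>)) \<partial>Q)
        \<le> ereal (integral\<^sup>L Q (?g 0)) + ereal (s - integral\<^sup>L Q (?g 0))"
      by (rule add_left_mono)
    moreover have "dual l = ereal (integral\<^sup>L Q (?g 0)) + enn2ereal (\<integral>\<^sup>+\<zeta>. e2ennreal (\<psi> l \<zeta> - ereal (?g 0 \<zeta>)) \<partial>Q)"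
      by (intro dual_eq g_int gain_le_psi T_mem)
    ultimately have "dual l \<le> ereal s" by simp
    then show False using s by simp
  qed
qed

section \<open>Plans and their second marginals\<close>

lemma plan_of_map:
  assumes T: "T \<in> M \<rightarrow>\<^sub>M M"
  defines "\<pi> \<equiv> distr Q (M \<Otimes>\<^sub>M M) (\<lambda>\<zeta>. (\<zeta>, T \<zeta>))"
  shows "\<pi> \<in> plans"
    "(\<integral>\<^sup>+z. ennreal (c (fst z) (snd z)) \<partial>\<pi>) = (\<integral>\<^sup>+\<zeta>. ennreal (c \<zeta> (T \<zeta>)) \<partial>Q)"
    "integrable \<pi> (\<lambda>z. h (snd z)) \<longleftrightarrow> integrable Q (\<lambda>\<zeta>. h (T \<zeta>))"
    "(\<integral>z. h (snd z) \<partial>\<pi>) = (\<integral>\<zeta>. h (T \<zeta>) \<partial>Q)"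
proof -
  interpret prob_space Q by (rule prob_space_Q)
  have m: "(\<lambda>\<zeta>. (\<zeta>, T \<zeta>)) \<in> Q \<rightarrow>\<^sub>M M \<Otimes>\<^sub>M M"
    unfolding measurable_Q using T by measurable
  have fst_m: "fst \<in> M \<Otimes>\<^sub>M M \<rightarrow>\<^sub>M Q"
    using measurable_cong_sets[OF refl sets_Q] measurable_fst by blast
  have "distr \<pi> Q fst = distr Q Q (\<lambda>\<zeta>. \<zeta>)"
    unfolding \<pi>_def by (subst distr_distr[OF fst_m m]) (simp add: o_def)
  then show "\<pi> \<in> plans"
    using prob_space_distr[OF m] by (simp add: plans_def \<pi>_def distr_id2)
  show "(\<integral>\<^sup>+z. ennreal (c (fst z) (snd z)) \<partial>\<pi>) = (\<integral>\<^sup>+\<zeta>. ennreal (c \<zeta> (T \<zeta>)) \<partial>Q)"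
    unfolding \<pi>_def by (subst nn_integral_distr[OF m]) auto
  show "integrable \<pi> (\<lambda>z. h (snd z)) \<longleftrightarrow> integrable Q (\<lambda>\<zeta>. h (T \<zeta>))"
    unfolding \<pi>_def by (subst integrable_distr_eq[OF m]) auto
  show "(\<integral>z. h (snd z) \<partial>\<pi>) = (\<integral>\<zeta>. h (T \<zeta>) \<partial>Q)"
    unfolding \<pi>_def by (subst integral_distr[OF m]) auto
qed

text \<open>The source of convexity in the separation argument: marginal, value and cost are all
  affine in the plan. The cost identity stays in \<open>ennreal\<close>, since a plan may have
  infinite cost.\<close>

lemma plans_mixture:
  assumes \<mu>: "\<mu> \<in> plans" "integrable \<mu> (\<lambda>z. h (snd z))"
    and \<nu>: "\<nu> \<in> plans" "integrable \<nu> (\<lambda>z. h (snd z))"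
    and t: "0 \<le> t" "t \<le> 1"
  obtains \<kappa> where "\<kappa> \<in> plans" "integrable \<kappa> (\<lambda>z. h (snd z))"
    "(\<integral>z. h (snd z) \<partial>\<kappa>) = t * (\<integral>z. h (snd z) \<partial>\<mu>) + (1 - t) * (\<integral>z. h (snd z) \<partial>\<nu>)"
    "(\<integral>\<^sup>+z. ennreal (c (fst z) (snd z)) \<partial>\<kappa>) =
      ennreal t * (\<integral>\<^sup>+z. ennreal (c (fst z) (snd z)) \<partial>\<mu>) +
      ennreal (1 - t) * (\<integral>\<^sup>+z. ennreal (c (fst z) (snd z)) \<partial>\<nu>)"
proof -
  let ?N = "M \<Otimes>\<^sub>M M"
  have p: "prob_space \<mu>" "sets \<mu> = sets ?N" "distr \<mu> Q fst = Q"
    "prob_space \<nu>" "sets \<nu> = sets ?N" "distr \<nu> Q fst = Q"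
    using assms by (auto simp: plans_def)
  obtain \<kappa> where \<kappa>: "prob_space \<kappa>" "sets \<kappa> = sets ?N"
    and mix: "\<And>f. f \<in> borel_measurable ?N \<Longrightarrow>
      (\<integral>\<^sup>+x. f x \<partial>\<kappa>) = ennreal t * (\<integral>\<^sup>+x. f x \<partial>\<mu>) + ennreal (1 - t) * (\<integral>\<^sup>+x. f x \<partial>\<nu>)"
    using mixture_measure[OF p(1,2,4,5) t] by metis
  have fst_m: "fst \<in> N \<rightarrow>\<^sub>M Q" if "sets N = sets ?N" for N
    using measurable_cong_sets[OF that sets_Q] measurable_fst by blast
  have "distr \<kappa> Q fst = Q"
  proof (rule measure_eqI)
    fix A assume "A \<in> sets (distr \<kappa> Q fst)"
    then have A: "A \<in> sets Q" by simp
    have ind: "(\<integral>\<^sup>+z. indicator A (fst z) \<partial>N) = emeasure (distr N Q fst) A" if "sets N = sets ?N" for N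
    proof -
      have "(\<integral>\<^sup>+z. indicator A (fst z) \<partial>N) = (\<integral>\<^sup>+x. indicator A x \<partial>distr N Q fst)"
        using A by (subst nn_integral_distr[OF fst_m[OF that]]) auto
      then show ?thesis using A by simp
    qed
    have "(\<lambda>z. indicator A (fst z) :: ennreal) \<in> borel_measurable ?N"
      using A sets_Q by measurable
    from mix[OF this] have "emeasure (distr \<kappa> Q fst) A = ennreal t * emeasure Q A + ennreal (1 - t) * emeasure Q A"
      by (simp add: ind \<kappa> p)
    also have "\<dots> = (ennreal t + ennreal (1 - t)) * emeasure Q A"
      by (simp add: distrib_right)
    also have "ennreal t + ennreal (1 - t) = 1"
      using t by (subst ennreal_plus[symmetric]) auto
    finally show "emeasure (distr \<kappa> Q fst) A = emeasure Q A" by simp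
  qed simp
  then have "\<kappa> \<in> plans" using \<kappa> by (simp add: plans_def)
  moreover note mixture_integrable[OF \<kappa>(2) p(2) p(5) mix t \<mu>(2) \<nu>(2)]
  moreover have "(\<integral>\<^sup>+z. ennreal (c (fst z) (snd z)) \<partial>\<kappa>) =
      ennreal t * (\<integral>\<^sup>+z. ennreal (c (fst z) (snd z)) \<partial>\<mu>) +
      ennreal (1 - t) * (\<integral>\<^sup>+z. ennreal (c (fst z) (snd z)) \<partial>\<nu>)"
    using c_measurable by (intro mix) measurable
  ultimately show thesis by (rule that)
qed

lemma snd_measurable: "sets N = sets (M \<Otimes>\<^sub>M M) \<Longrightarrow> sets P = sets M \<Longrightarrow> snd \<in> N \<rightarrow>\<^sub>M P"
  using measurable_cong_sets[of N "M \<Otimes>\<^sub>M M" P M] measurable_snd by blast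

text \<open>The ball also demands a finite moment. It follows from comparing \<open>snd z\<close>
  with \<open>x0\<close> by way of \<open>fst z\<close>, whose moment is that of \<open>Q\<close>.
  Afterwards the plan itself is a coupling that witnesses the distance bound.\<close>

lemma plan_marginal_in_ball:
  assumes \<pi>: "\<pi> \<in> plans" and cost: "(\<integral>\<^sup>+z. ennreal (c (fst z) (snd z)) \<partial>\<pi>) \<le> ennreal (\<epsilon> powr p)"
  shows "distr \<pi> M snd \<in> wasserstein_ball p X Q \<epsilon>"
proof -
  interpret prob_space Q by (rule prob_space_Q)
  let ?P = "distr \<pi> M snd"
  have p: "prob_space \<pi>" "sets \<pi> = sets (M \<Otimes>\<^sub>M M)" "distr \<pi> Q fst = Q"
    using \<pi> by (auto simp: plans_def)
  have snd_m: "snd \<in> \<pi> \<rightarrow>\<^sub>M M" using snd_measurable p(2) by blast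
  have fst_m: "fst \<in> \<pi> \<rightarrow>\<^sub>M Q"
    using measurable_cong_sets[OF p(2) sets_Q] measurable_fst by blast
  have space_\<pi>: "space \<pi> = mspace X \<times> mspace X"
    using sets_eq_imp_space_eq[OF p(2)] by (simp add: space_pair_measure)
  obtain x0 where x0: "x0 \<in> mspace X" using not_empty by auto
  have cx: "(\<lambda>\<zeta>. c \<zeta> x0) \<in> borel_measurable M"
    using x0 by (intro c_measurable1) auto
  have cm: "(\<lambda>z. c (fst z) (snd z)) \<in> borel_measurable \<pi>"
    using measurable_cong_sets[OF p(2) refl] c_measurable by blast
  have "(\<integral>\<^sup>+x. ennreal (c x x0) \<partial>?P) = (\<integral>\<^sup>+z. ennreal (c (snd z) x0) \<partial>\<pi>)"
    using cx by (subst nn_integral_distr[OF snd_m]) auto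
  also have "\<dots> \<le> (\<integral>\<^sup>+z. ennreal (2 powr p) * (ennreal (c (fst z) (snd z)) + ennreal (c (fst z) x0)) \<partial>\<pi>)"
  proof (rule nn_integral_mono)
    fix z assume "z \<in> space \<pi>"
    then have "c (snd z) x0 \<le> 2 powr p * (c (fst z) (snd z) + c (fst z) x0)"
      using powr_mdist_triangle[OF p_ge_1, of "snd z" X "fst z" x0] x0
      by (auto simp: c_def space_\<pi> mdist_commute[of X "snd z"])
    then have "ennreal (c (snd z) x0) \<le> ennreal (2 powr p * (c (fst z) (snd z) + c (fst z) x0))"
      by (rule ennreal_leI)
    then show "ennreal (c (snd z) x0) \<le> ennreal (2 powr p) * (ennreal (c (fst z) (snd z)) + ennreal (c (fst z) x0))"
      by (simp add: ennreal_mult ennreal_plus)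
  qed
  also have "\<dots> = ennreal (2 powr p) * ((\<integral>\<^sup>+z. ennreal (c (fst z) (snd z)) \<partial>\<pi>) + (\<integral>\<^sup>+z. ennreal (c (fst z) x0) \<partial>\<pi>))"
  proof -
    have "(\<lambda>z. c (fst z) x0) \<in> borel_measurable \<pi>"
      using measurable_compose[OF fst_m, of "\<lambda>\<zeta>. c \<zeta> x0" borel] cx by (simp add: measurable_Q)
    then show ?thesis using cm by (subst nn_integral_cmult) (auto simp: nn_integral_add)
  qed
  also have "(\<integral>\<^sup>+z. ennreal (c (fst z) x0) \<partial>\<pi>) = (\<integral>\<^sup>+\<zeta>. ennreal (c \<zeta> x0) \<partial>Q)"
    using cx by (subst p(3)[symmetric], subst nn_integral_distr[OF fst_m]) (auto simp: measurable_Q)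
  also have "ennreal (2 powr p) * ((\<integral>\<^sup>+z. ennreal (c (fst z) (snd z)) \<partial>\<pi>) + \<dots>) < \<infinity>"
  proof -
    have "(\<integral>\<^sup>+z. ennreal (c (fst z) (snd z)) \<partial>\<pi>) < top"
      using cost by (rule le_less_trans) simp
    moreover have "(\<integral>\<^sup>+\<zeta>. ennreal (c \<zeta> x0) \<partial>Q) < top"
      using c_integrable[OF x0] by (auto simp: real_integrable_def less_top)
    ultimately show ?thesis by (simp add: ennreal_mult_less_top)
  qed
  finally have P: "?P \<in> prob_measures p X"
    using x0 prob_space.prob_space_distr[OF p(1) snd_m] by (auto simp: prob_measures_def c_def)
  have "sets (Q \<Otimes>\<^sub>M ?P) = sets \<pi>"
    unfolding p(2) by (rule sets_pair_measure_cong) (auto simp: sets_Q)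
  moreover have "distr \<pi> ?P snd = ?P"
    by (rule distr_cong) auto
  ultimately have "\<pi> \<in> couplings Q ?P"
    using p by (auto simp: couplings_def)
  then have "transport_cost p X Q ?P \<le> (\<integral>\<^sup>+z. ennreal (c (fst z) (snd z)) \<partial>\<pi>)"
    unfolding transport_cost_def c_def by (rule INF_lower)
  then have tc: "transport_cost p X Q ?P \<le> ennreal (\<epsilon> powr p)"
    using cost by (rule order_trans)
  then have "enn2real (transport_cost p X Q ?P) \<le> \<epsilon> powr p"
    using enn2real_mono[OF tc] by simp
  then have "enn2real (transport_cost p X Q ?P) powr (1 / p) \<le> (\<epsilon> powr p) powr (1 / p)"
    using p_ge_1 by (intro powr_mono2) auto
  also have "\<dots> = \<epsilon>" using p_ge_1 eps_pos by (simp add: powr_powr)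
  finally have "wasserstein p X Q ?P \<le> ennreal \<epsilon>"
    using tc by (auto simp: wasserstein_def top_unique intro: ennreal_leI)
  then show ?thesis using P by (simp add: wasserstein_ball_def)
qed

section \<open>Weak duality\<close>

lemma transport_cost_le_of_ball:
  assumes "P \<in> wasserstein_ball p X Q \<epsilon>"
  shows "transport_cost p X Q P \<le> ennreal (\<epsilon> powr p)"
proof -
  have w: "wasserstein p X Q P \<le> ennreal \<epsilon>" using assms by (simp add: wasserstein_ball_def)
  then have fin: "transport_cost p X Q P \<noteq> \<infinity>"
    by (auto simp: wasserstein_def top_unique)
  then obtain r where r: "0 \<le> r" "transport_cost p X Q P = ennreal r"
    by (cases "transport_cost p X Q P") auto
  then have "r powr (1 / p) \<le> \<epsilon>"
    using w eps_pos by (simp add: wasserstein_def ennreal_le_iff)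
  then have "(r powr (1 / p)) powr p \<le> \<epsilon> powr p"
    using p_ge_1 by (intro powr_mono2) auto
  then have "r \<le> \<epsilon> powr p" using r p_ge_1 by (simp add: powr_powr)
  then show ?thesis using r by (simp add: ennreal_leI)
qed

text \<open>Integrating \<open>h \<xi> \<le> \<psi> l \<zeta> + l * (c \<zeta> \<xi> - \<epsilon>
  powr p)\<close> against a coupling bounds the expectation by the dual value. The claim on the
  positive part is what excludes an expectation of \<open>\<infinity>\<close> and lets several
  factors be added.\<close>

lemma weak_duality:
  assumes l: "0 \<le> l" and P: "P \<in> wasserstein_ball p X Q \<epsilon>" and fin: "dual l < \<infinity>"
  shows "integrable P (\<lambda>x. max 0 (h x))"
    and "integrable P h \<Longrightarrow> ereal (\<integral>x. h x \<partial>P) \<le> dual l"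
proof -
  let ?f = "\<lambda>\<zeta>. h \<zeta> + l * \<epsilon> powr p"
  let ?u = "\<lambda>\<zeta>. e2ennreal (\<psi> l \<zeta> - ereal (?f \<zeta>))"
  \<comment> \<open>A real-valued version of \<open>\<psi> l\<close>: \<open>enn2real\<close> sends
    \<open>\<infinity>\<close> to \<open>0\<close>, but a finite dual value confines this to a null
    set.\<close>
  define q where "q \<zeta> = ?f \<zeta> + enn2real (?u \<zeta>)" for \<zeta>
  note deq = dual_eq[OF gain_self_integrable(1) gain_self_le_psi]
  have u_meas: "?u \<in> borel_measurable Q"
    using psi_measurable borel_measurable_integrable[OF gain_self_integrable(1)] by measurable
  have u_fin: "(\<integral>\<^sup>+\<zeta>. ?u \<zeta> \<partial>Q) \<noteq> \<infinity>"
    using fin deq by auto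
  have u_ae: "AE \<zeta> in Q. ?u \<zeta> \<noteq> \<infinity>"
    using u_meas u_fin by (intro nn_integral_PInf_AE) auto
  have u_eq: "(\<integral>\<^sup>+\<zeta>. ?u \<zeta> \<partial>Q) = (\<integral>\<^sup>+\<zeta>. ennreal (enn2real (?u \<zeta>)) \<partial>Q)"
    using u_ae by (intro nn_integral_cong_AE) (auto simp: less_top)
  have u_int: "integrable Q (\<lambda>\<zeta>. enn2real (?u \<zeta>))"
    using u_fin u_meas by (intro integrableI_nonneg) (auto simp: less_top u_eq)
  have q_int: "integrable Q q"
    unfolding q_def by (rule Bochner_Integration.integrable_add[OF gain_self_integrable(1) u_int])
  have q_dual: "ereal (integral\<^sup>L Q q) = dual l"
    unfolding q_def using deq u_int gain_self_integrable
    by (simp add: u_eq nn_integral_eq_integral[OF u_int] enn2ereal_ennreal del: Bochner_Integration.integrable_add)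
  \<comment> \<open>The quantifier over \<open>\<xi>\<close> sits inside: the exceptional set
    depends on \<open>\<zeta>\<close> alone, so it is null under every coupling with first marginal
    \<open>Q\<close>.\<close>
  have q_ae: "AE \<zeta> in Q. \<forall>\<xi>\<in>mspace X. h \<xi> \<le> q \<zeta> + l * (c \<zeta> \<xi> - \<epsilon> powr p)"
    using u_ae AE_space
  proof eventually_elim
    case (elim \<zeta>)
    show ?case
    proof
      fix \<xi> assume "\<xi> \<in> mspace X"
      then have "ereal (gain l \<zeta> \<xi>) \<le> \<psi> l \<zeta>" by (rule gain_le_psi)
      moreover have "\<psi> l \<zeta> = ereal (q \<zeta>)"
        using elim gain_self_le_psi[of \<zeta> l] by (cases "\<psi> l \<zeta>") (auto simp: q_def)
      ultimately show "h \<xi> \<le> q \<zeta> + l * (c \<zeta> \<xi> - \<epsilon> powr p)"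
        by (simp add: gain_def algebra_simps)
    qed
  qed
  have PP: "prob_space P" "sets P = sets M"
    using P by (auto simp: wasserstein_ball_def prob_measures_def)
  have h_P: "h \<in> borel_measurable P"
    using measurable_cong_sets[OF PP(2) refl] h_measurable by blast
  \<comment> \<open>Only near-optimal couplings are extracted from the infimum, at the price of a
    slack \<open>\<delta>\<close> in the cost.\<close>
  have dominated: "\<exists>\<pi>. sets \<pi> = sets (M \<Otimes>\<^sub>M M) \<and> distr \<pi> Q fst = Q \<and> distr \<pi> P snd = P \<and>
    integrable \<pi> (\<lambda>z. c (fst z) (snd z)) \<and> (\<integral>z. c (fst z) (snd z) \<partial>\<pi>) \<le> \<epsilon> powr p + \<delta>"
    if \<delta>: "0 < \<delta>" for \<delta>
  proof -
    have "transport_cost p X Q P < ennreal (\<epsilon> powr p + \<delta>)"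
      using transport_cost_le_of_ball[OF P] by (rule le_less_trans) (use \<delta> in \<open>simp add: ennreal_lessI\<close>)
    then obtain \<pi> where \<pi>: "\<pi> \<in> couplings Q P"
      and cost: "(\<integral>\<^sup>+z. ennreal (c (fst z) (snd z)) \<partial>\<pi>) < ennreal (\<epsilon> powr p + \<delta>)"
      unfolding transport_cost_def INF_less_iff c_def by blast
    have sets: "sets \<pi> = sets (M \<Otimes>\<^sub>M M)"
      using \<pi> sets_pair_measure_cong[OF sets_Q PP(2)] by (simp add: couplings_def)
    have cm: "(\<lambda>z. c (fst z) (snd z)) \<in> borel_measurable \<pi>"
      using measurable_cong_sets[OF sets refl] c_measurable by blast
    have ci: "integrable \<pi> (\<lambda>z. c (fst z) (snd z))"
      using cost cm by (intro integrableI_nonneg) (auto intro: less_trans)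
    moreover have "(\<integral>z. c (fst z) (snd z) \<partial>\<pi>) \<le> \<epsilon> powr p + \<delta>"
    proof (rule ennreal_le_iff[THEN iffD1])
      show "ennreal (\<integral>z. c (fst z) (snd z) \<partial>\<pi>) \<le> ennreal (\<epsilon> powr p + \<delta>)"
        using cost nn_integral_eq_integral[OF ci] by simp
    qed (use \<delta> in simp)
    ultimately show ?thesis using \<pi> sets by (auto simp: couplings_def)
  qed
  have bound: "AE z in \<pi>. h (snd z) \<le> q (fst z) + l * (c (fst z) (snd z) - \<epsilon> powr p)"
    "integrable \<pi> (\<lambda>z. q (fst z))" "(\<integral>z. q (fst z) \<partial>\<pi>) = integral\<^sup>L Q q" "prob_space \<pi>"
    "snd \<in> \<pi> \<rightarrow>\<^sub>M P"
    if sets: "sets \<pi> = sets (M \<Otimes>\<^sub>M M)" and Qm: "distr \<pi> Q fst = Q" for \<pi>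
  proof -
    have fst_m: "fst \<in> \<pi> \<rightarrow>\<^sub>M Q"
      using measurable_cong_sets[OF sets sets_Q] measurable_fst by blast
    have "AE \<zeta> in distr \<pi> Q fst. \<forall>\<xi>\<in>mspace X. h \<xi> \<le> q \<zeta> + l * (c \<zeta> \<xi> - \<epsilon> powr p)"
      unfolding Qm by (rule q_ae)
    from AE_distrD[OF fst_m this] AE_space
    show "AE z in \<pi>. h (snd z) \<le> q (fst z) + l * (c (fst z) (snd z) - \<epsilon> powr p)"
      by eventually_elim (auto simp: sets_eq_imp_space_eq[OF sets] space_pair_measure)
    show "integrable \<pi> (\<lambda>z. q (fst z))"
      using q_int integrable_distr[OF fst_m, of q] by (simp add: Qm)
    show "(\<integral>z. q (fst z) \<partial>\<pi>) = integral\<^sup>L Q q"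
      using integral_distr[OF fst_m borel_measurable_integrable[OF q_int]] by (simp add: Qm)
    show "prob_space \<pi>"
      using prob_space_distrD[OF fst_m] prob_space_Q by (simp add: Qm)
    show "snd \<in> \<pi> \<rightarrow>\<^sub>M P" by (rule snd_measurable[OF sets PP(2)])
  qed
  show "integrable P (\<lambda>x. max 0 (h x))"
  proof -
    obtain \<pi> where \<pi>: "sets \<pi> = sets (M \<Otimes>\<^sub>M M)" "distr \<pi> Q fst = Q" "distr \<pi> P snd = P"
      "integrable \<pi> (\<lambda>z. c (fst z) (snd z))"
      using dominated[of 1] by auto
    note b = bound[OF \<pi>(1,2)]
    interpret \<pi>: prob_space \<pi> by (rule b(4))
    have h_\<pi>: "(\<lambda>z. h (snd z)) \<in> borel_measurable \<pi>"
      using measurable_compose[OF b(5) h_P] by simp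
    have "integrable \<pi> (\<lambda>z. max 0 (h (snd z)))"
    proof (rule Bochner_Integration.integrable_bound)
      show "integrable \<pi> (\<lambda>z. \<bar>q (fst z) + l * (c (fst z) (snd z) - \<epsilon> powr p)\<bar>)"
        using b(2) \<pi>(4) by auto
      show "AE z in \<pi>. norm (max 0 (h (snd z))) \<le> norm \<bar>q (fst z) + l * (c (fst z) (snd z) - \<epsilon> powr p)\<bar>"
        using b(1) by eventually_elim auto
    qed (use h_\<pi> in measurable)
    then have "integrable (distr \<pi> P snd) (\<lambda>x. max 0 (h x))"
      using h_P by (subst integrable_distr_eq[OF b(5)]) auto
    then show ?thesis by (simp add: \<pi>(3))
  qed
  show "ereal (\<integral>x. h x \<partial>P) \<le> dual l" if h_int: "integrable P h"
  proof -
    have "(\<integral>x. h x \<partial>P) \<le> integral\<^sup>L Q q + l * \<delta>" if \<delta>: "0 < \<delta>" for \<delta>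
    proof -
      obtain \<pi> where \<pi>: "sets \<pi> = sets (M \<Otimes>\<^sub>M M)" "distr \<pi> Q fst = Q" "distr \<pi> P snd = P"
        "integrable \<pi> (\<lambda>z. c (fst z) (snd z))" "(\<integral>z. c (fst z) (snd z) \<partial>\<pi>) \<le> \<epsilon> powr p + \<delta>"
        using dominated[OF \<delta>] by auto
      note b = bound[OF \<pi>(1,2)]
      interpret \<pi>: prob_space \<pi> by (rule b(4))
      have h_\<pi>: "integrable \<pi> (\<lambda>z. h (snd z))"
        using h_int integrable_distr[OF b(5), of h] by (simp add: \<pi>(3))
      have "(\<integral>x. h x \<partial>P) = (\<integral>z. h (snd z) \<partial>\<pi>)"
        using integral_distr[OF b(5) h_P] by (simp add: \<pi>(3))
      also have "\<dots> \<le> (\<integral>z. q (fst z) + l * (c (fst z) (snd z) - \<epsilon> powr p) \<partial>\<pi>)"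
        using h_\<pi> b(1,2) \<pi>(4) by (intro integral_mono_AE) auto
      also have "\<dots> = integral\<^sup>L Q q + l * ((\<integral>z. c (fst z) (snd z) \<partial>\<pi>) - \<epsilon> powr p)"
        using b(2,3) \<pi>(4) by (simp add: \<pi>.prob_space)
      also have "\<dots> \<le> integral\<^sup>L Q q + l * \<delta>"
        using l \<pi>(5) by (intro add_left_mono mult_left_mono) auto
      finally show ?thesis .
    qed
    note le = this
    have "(\<integral>x. h x \<partial>P) \<le> integral\<^sup>L Q q"
    proof (rule field_le_epsilon)
      fix e :: real assume e: "0 < e"
      \<comment> \<open>The slack \<open>e / (l + 1)\<close> costs at most \<open>e\<close> at price
        \<open>l\<close>, and it is also defined and positive for \<open>l = 0\<close>.\<close>
      have "l * (e / (l + 1)) \<le> e" using l e by (simp add: field_simps)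
      moreover have "(\<integral>x. h x \<partial>P) \<le> integral\<^sup>L Q q + l * (e / (l + 1))"
        using l e by (intro le) auto
      ultimately show "(\<integral>x. h x \<partial>P) \<le> integral\<^sup>L Q q + e" by simp
    qed
    then show ?thesis unfolding q_dual[symmetric] by simp
  qed
qed

section \<open>Strong duality by separation\<close>

text \<open>A real threshold below all dual values covers finite and infinite dual infima alike, and
  it yields a single measure with integrable \<open>h\<close> instead of a supremum.\<close>

lemma strong_duality:
  assumes r: "\<And>l. 0 \<le> l \<Longrightarrow> ereal r < dual l"
  shows "\<exists>P\<in>wasserstein_ball p X Q \<epsilon>. integrable P h \<and> r < (\<integral>x. h x \<partial>P)"
proof -
  interpret prob_space Q by (rule prob_space_Q)
  define cost where "cost \<pi> = (\<integral>\<^sup>+z. ennreal (c (fst z) (snd z)) \<partial>\<pi>)" for \<pi>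
  define val where "val \<pi> = (\<integral>z. h (snd z) \<partial>\<pi>)" for \<pi> :: "('a \<times> 'a) measure"
  \<comment> \<open>The inequality \<open>cost \<pi> \<le> ennreal a\<close> with real
    \<open>a\<close> restricts \<open>A\<close> to plans of finite cost. The condition
    \<open>0 \<le> a\<close> is essential because \<open>ennreal\<close> maps negative numbers to
    \<open>0\<close>.\<close>
  define A where "A = {(a, e). 0 \<le> a \<and> (\<exists>\<pi>\<in>plans. integrable \<pi> (\<lambda>z. h (snd z)) \<and>
    cost \<pi> \<le> ennreal a \<and> e \<le> val \<pi>)}"
  \<comment> \<open>\<open>A\<close> meets this quadrant exactly when some plan within the budget
    has value above \<open>r\<close>. Its two unbounded directions fix the signs of the separating
    normal.\<close>
  define B where "B = {..\<epsilon> powr p} \<times> {r<..}"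
  have A_map: "((\<integral>\<zeta>. c \<zeta> (T \<zeta>) \<partial>Q), (\<integral>\<zeta>. h (T \<zeta>) \<partial>Q)) \<in> A"
    if T: "T \<in> M \<rightarrow>\<^sub>M M" "integrable Q (\<lambda>\<zeta>. h (T \<zeta>))" "integrable Q (\<lambda>\<zeta>. c \<zeta> (T \<zeta>))" for T
    using plan_of_map[OF T(1)] T nn_integral_eq_integral[OF T(3)]
    by (auto simp: A_def cost_def val_def intro!: bexI)
  have "A \<inter> B \<noteq> {}"
  proof
    assume disj: "A \<inter> B = {}"
    have "convex A"
    proof (rule convexI)
      fix x y and u v :: real
      assume xy: "x \<in> A" "y \<in> A" and uv: "0 \<le> u" "0 \<le> v" "u + v = 1"
      obtain a1 e1 \<mu> where 1: "x = (a1, e1)" "0 \<le> a1" "\<mu> \<in> plans" "integrable \<mu> (\<lambda>z. h (snd z))"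
        "cost \<mu> \<le> ennreal a1" "e1 \<le> val \<mu>"
        using xy(1) by (auto simp: A_def)
      obtain a2 e2 \<nu> where 2: "y = (a2, e2)" "0 \<le> a2" "\<nu> \<in> plans" "integrable \<nu> (\<lambda>z. h (snd z))"
        "cost \<nu> \<le> ennreal a2" "e2 \<le> val \<nu>"
        using xy(2) by (auto simp: A_def)
      have v: "v = 1 - u" using uv by simp
      obtain \<kappa> where \<kappa>: "\<kappa> \<in> plans" "integrable \<kappa> (\<lambda>z. h (snd z))"
        "val \<kappa> = u * val \<mu> + v * val \<nu>" "cost \<kappa> = ennreal u * cost \<mu> + ennreal v * cost \<nu>"
        unfolding val_def cost_def v
        by (rule plans_mixture[OF 1(3,4) 2(3,4)]) (use uv in auto)
      have "cost \<kappa> \<le> ennreal u * ennreal a1 + ennreal v * ennreal a2"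
        unfolding \<kappa>(4) using 1 2 by (intro add_mono mult_left_mono) auto
      also have "\<dots> = ennreal (u * a1 + v * a2)"
        using uv 1 2 by (simp add: ennreal_mult ennreal_plus)
      finally have "cost \<kappa> \<le> ennreal (u * a1 + v * a2)" .
      moreover have "u * e1 + v * e2 \<le> val \<kappa>"
        unfolding \<kappa>(3) using 1 2 uv by (intro add_mono mult_left_mono) auto
      ultimately show "u *\<^sub>R x + v *\<^sub>R y \<in> A"
        using \<kappa>(1,2) 1 2 uv by (auto simp: A_def)
    qed
    moreover have "convex B" unfolding B_def by (intro convex_Times) auto
    moreover have A_id: "(0, integral\<^sup>L Q h) \<in> A"
    proof -
      have z: "(\<integral>\<zeta>. c \<zeta> \<zeta> \<partial>Q) = (\<integral>\<zeta>. 0 \<partial>Q)" "integrable Q (\<lambda>\<zeta>. c \<zeta> \<zeta>) \<longleftrightarrow> integrable Q (\<lambda>\<zeta>. 0::real)"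
        by (intro Bochner_Integration.integral_cong Bochner_Integration.integrable_cong; simp)+
      show ?thesis using A_map[of "\<lambda>\<zeta>. \<zeta>"] h_integrable by (simp add: z)
    qed
    moreover have "(\<epsilon> powr p, r + 1) \<in> B" by (simp add: B_def)
    ultimately obtain w b where w: "w \<noteq> 0" "\<forall>x\<in>A. inner w x \<le> b" "\<forall>x\<in>B. b \<le> inner w x"
      using separating_hyperplane_sets[of A B] disj by blast
    obtain w1 w2 where w12: "w = (w1, w2)" by (cases w)
    have wA: "w1 * a + w2 * e \<le> b" if "(a, e) \<in> A" for a e
      using w(2) that by (force simp: w12)
    have wB: "b \<le> w1 * a + w2 * e" if "a \<le> \<epsilon> powr p" "r < e" for a e
      using w(3) that by (force simp: w12 B_def)
    have w1: "w1 \<le> 0"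
    proof (rule ccontr)
      assume n: "\<not> w1 \<le> 0"
      \<comment> \<open>Far enough out in \<open>B\<close> for the functional to drop to
        \<open>b - 1\<close>, below its lower bound \<open>b\<close>; \<open>?e\<close> plays the
        same role for \<open>w2\<close>.\<close>
      let ?a = "min (\<epsilon> powr p) ((b - w2 * (r + 1) - 1) / w1)"
      have "w1 * ?a \<le> w1 * ((b - w2 * (r + 1) - 1) / w1)"
        using n by (intro mult_left_mono) auto
      also have "\<dots> = b - w2 * (r + 1) - 1" using n by simp
      finally show False using wB[of ?a "r + 1"] by simp
    qed
    have w2: "0 \<le> w2"
    proof (rule ccontr)
      assume n: "\<not> 0 \<le> w2"
      let ?e = "max (r + 1) ((b - w1 * \<epsilon> powr p - 1) / w2)"
      have "w2 * ?e \<le> w2 * ((b - w1 * \<epsilon> powr p - 1) / w2)"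
        using n by (intro mult_left_mono_neg) auto
      also have "\<dots> = b - w1 * \<epsilon> powr p - 1" using n by simp
      finally show False using wB[of "\<epsilon> powr p" ?e] by (simp add: less_max_iff_disj)
    qed
    have eps: "0 < \<epsilon> powr p" using eps_pos by simp
    \<comment> \<open>Slater's condition: the identity plan has cost \<open>0\<close>, strictly
      below the budget. A vertical line would need
      \<open>0 \<le> b \<le> w1 * \<epsilon> powr p\<close> with \<open>w1 < 0\<close>.\<close>
    have w2_pos: "0 < w2"
    proof (rule ccontr)
      assume "\<not> 0 < w2"
      then have "w2 = 0" using w2 by simp
      then have "w1 < 0" using w(1) w1 by (simp add: w12 zero_prod_def)
      have "0 \<le> w1 * \<epsilon> powr p"
        using wA[OF A_id] wB[of "\<epsilon> powr p" "r + 1"] \<open>w2 = 0\<close> by simp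
      then show False using \<open>w1 < 0\<close> eps by (simp add: zero_le_mult_iff)
    qed
    \<comment> \<open>The corner of the quadrant is not in \<open>B\<close>, whose values exceed
      \<open>r\<close> strictly; it is reached by a limit along the edge.\<close>
    have b: "b \<le> w1 * \<epsilon> powr p + w2 * r"
    proof (rule field_le_epsilon)
      fix d :: real assume "0 < d"
      have "w2 * (r + d / w2) = w2 * r + d" using w2_pos by (simp add: distrib_left)
      then show "b \<le> w1 * \<epsilon> powr p + w2 * r + d"
        using wB[of "\<epsilon> powr p" "r + d / w2"] w2_pos \<open>0 < d\<close> by simp
    qed
    \<comment> \<open>With the normal rescaled to \<open>(- l, 1)\<close>, the functional is value
      minus priced cost, so the slope is the multiplier.\<close>
    define l where "l = - w1 / w2"
    have l: "0 \<le> l" using w1 w2 by (simp add: l_def divide_nonpos_nonneg)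
    obtain T where T: "T \<in> M \<rightarrow>\<^sub>M M" "integrable Q (\<lambda>\<zeta>. h (T \<zeta>))" "integrable Q (\<lambda>\<zeta>. c \<zeta> (T \<zeta>))"
      "r < (\<integral>\<zeta>. gain l \<zeta> (T \<zeta>) \<partial>Q)"
      by (rule near_optimal_map[OF r[OF l]])
    let ?a = "\<integral>\<zeta>. c \<zeta> (T \<zeta>) \<partial>Q" and ?e = "\<integral>\<zeta>. h (T \<zeta>) \<partial>Q"
    have "(\<integral>\<zeta>. gain l \<zeta> (T \<zeta>) \<partial>Q) = ?e + l * (\<epsilon> powr p - ?a)"
      using T(2,3) prob_space by (simp add: gain_def)
    then have "w2 * r < w2 * (?e + l * (\<epsilon> powr p - ?a))"
      using T(4) w2_pos by simp
    also have "\<dots> = w2 * ?e + w1 * ?a - w1 * \<epsilon> powr p"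
      using w2_pos by (simp add: l_def field_simps)
    \<comment> \<open>The pair of \<open>T\<close> lies on the side of \<open>A\<close>, the corner
      on the side of \<open>B\<close>, which caps the gain of \<open>T\<close> at
      \<open>r\<close>.\<close>
    also have "\<dots> \<le> w2 * r"
      using wA[OF A_map[OF T(1-3)]] b by simp
    finally show False by simp
  qed
  then obtain a e \<pi> where \<pi>: "a \<le> \<epsilon> powr p" "r < e" "\<pi> \<in> plans" "integrable \<pi> (\<lambda>z. h (snd z))"
    "cost \<pi> \<le> ennreal a" "e \<le> val \<pi>"
    by (auto simp: A_def B_def)
  have snd_m: "snd \<in> \<pi> \<rightarrow>\<^sub>M M" using \<pi>(3) by (intro snd_measurable) (auto simp: plans_def)
  have "cost \<pi> \<le> ennreal (\<epsilon> powr p)"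
    using \<pi>(1,5) by (meson ennreal_leI order_trans)
  then have "distr \<pi> M snd \<in> wasserstein_ball p X Q \<epsilon>"
    using plan_marginal_in_ball[OF \<pi>(3)] by (simp add: cost_def)
  moreover have "integrable (distr \<pi> M snd) h"
    using \<pi>(4) by (subst integrable_distr_eq[OF snd_m]) auto
  moreover have "r < (\<integral>x. h x \<partial>distr \<pi> M snd)"
    using \<pi>(2,6) by (subst integral_distr[OF snd_m]) (auto simp: val_def)
  ultimately show ?thesis by blast
qed

section \<open>Ingredients for products of nonnegative functions\<close>

lemma ball_nonempty: "Q \<in> wasserstein_ball p X Q \<epsilon>"
proof -
  have T: "(\<lambda>\<zeta>. \<zeta>) \<in> M \<rightarrow>\<^sub>M M" by simp
  let ?\<pi> = "distr Q (M \<Otimes>\<^sub>M M) (\<lambda>\<zeta>. (\<zeta>, \<zeta>))"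
  have "(\<integral>\<^sup>+\<zeta>. ennreal (c \<zeta> \<zeta>) \<partial>Q) = (\<integral>\<^sup>+\<zeta>. 0 \<partial>Q)"
    by (intro nn_integral_cong) simp
  then have "distr ?\<pi> M snd \<in> wasserstein_ball p X Q \<epsilon>"
    using plan_of_map(1,2)[OF T] by (intro plan_marginal_in_ball) auto
  moreover have "distr ?\<pi> M snd = Q"
  proof -
    have "(\<lambda>\<zeta>. (\<zeta>, \<zeta>)) \<in> Q \<rightarrow>\<^sub>M M \<Otimes>\<^sub>M M" unfolding measurable_Q by measurable
    then show ?thesis
      by (subst distr_distr) (auto simp: o_def sets_Q intro: distr_id2)
  qed
  ultimately show ?thesis by simp
qed

text \<open>If \<open>h x > 0\<close>, then moving to \<open>x\<close> is profitable for small multipliers, while the term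
  \<open>l * \<epsilon> powr p\<close> keeps the dual value away from \<open>0\<close> for the others.\<close>

lemma dual_bounded_away_from_0:
  assumes nonneg: "\<And>x. x \<in> mspace X \<Longrightarrow> 0 \<le> h x" and x: "x \<in> mspace X" "0 < h x"
  shows "\<exists>r>0. \<forall>l\<ge>0. ereal r < dual l"
proof -
  \<comment> \<open>\<open>D\<close> bounds the cost of sending all mass to \<open>x\<close>, with
    \<open>+ 1\<close> to make it positive. Up to \<open>l0\<close> this cost, priced at
    \<open>l\<close>, consumes at most half of \<open>h x\<close>; beyond \<open>l0\<close> the
    budget term alone is large. The outer halving in \<open>r\<close> makes both comparisons
    strict.\<close>
  define D where "D = \<bar>\<integral>\<zeta>. c \<zeta> x \<partial>Q\<bar> + 1"
  define l0 where "l0 = h x / (2 * D)"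
  define r where "r = min (h x / 2) (l0 * \<epsilon> powr p) / 2"
  have D: "0 < D" "(\<integral>\<zeta>. c \<zeta> x \<partial>Q) \<le> D" 
    using abs_ge_zero[of "\<integral>\<zeta>. c \<zeta> x \<partial>Q"] abs_ge_self[of "\<integral>\<zeta>. c \<zeta> x \<partial>Q"]
    unfolding D_def by linarith+
  have l0: "0 < l0" using x D by (simp add: l0_def)
  have eps: "0 < \<epsilon> powr p" using eps_pos by simp
  have r: "0 < r" "r < h x / 2" "r < l0 * \<epsilon> powr p"
  proof -
    have "0 < min (h x / 2) (l0 * \<epsilon> powr p)" using x l0 eps by simp
    then show "0 < r" "r < h x / 2" "r < l0 * \<epsilon> powr p" unfolding r_def by linarith+
  qed
  have "ereal r < dual l" if l: "0 \<le> l" for l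
  proof (cases "l \<le> l0")
    case True
    have "l * D \<le> l0 * D" using True D by (intro mult_right_mono) auto
    then have "l * D \<le> h x / 2" using D by (simp add: l0_def)
    moreover have "l * (\<integral>\<zeta>. c \<zeta> x \<partial>Q) \<le> l * D" using l D by (intro mult_left_mono) auto
    moreover have "0 \<le> l * \<epsilon> powr p" using l by simp
    ultimately have "r < h x + l * (\<epsilon> powr p - (\<integral>\<zeta>. c \<zeta> x \<partial>Q))"
      using r by (simp add: right_diff_distrib)
    then show ?thesis
      using dual_ge_const[OF x(1), of l] by (meson ereal_less_eq(3) less_ereal.simps(1) less_le_trans)
  next
    case False
    have "0 \<le> integral\<^sup>L Q h" using nonneg by (intro integral_nonneg_AE AE_I2) auto
    moreover have "l0 * \<epsilon> powr p \<le> l * \<epsilon> powr p" using False by (intro mult_right_mono) auto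
    ultimately have "r < integral\<^sup>L Q h + l * \<epsilon> powr p" using r by linarith
    then show ?thesis
      using dual_ge_self[of l] by (meson less_ereal.simps(1) less_le_trans)
  qed
  then show ?thesis using r by blast
qed

lemma dual_0_eq_0:
  assumes "\<And>x. x \<in> mspace X \<Longrightarrow> h x = 0"
  shows "dual 0 = 0"
proof -
  interpret prob_space Q by (rule prob_space_Q)
  have "\<psi> 0 \<zeta> = 0" if "\<zeta> \<in> mspace X" for \<zeta>
  proof -
    have "\<psi> 0 \<zeta> = (SUP \<xi>\<in>mspace X. 0)"
      unfolding \<psi>_def using assms by (intro SUP_cong) (auto simp: gain_def)
    moreover have "mspace X \<noteq> {}" using that by blast
    ultimately show ?thesis by simp
  qed
  then have "(\<integral>\<^sup>+\<zeta>. e2ennreal (\<psi> 0 \<zeta>) \<partial>Q) = (\<integral>\<^sup>+\<zeta>. 0 \<partial>Q)"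
    "(\<integral>\<^sup>+\<zeta>. e2ennreal (- \<psi> 0 \<zeta>) \<partial>Q) = (\<integral>\<^sup>+\<zeta>. 0 \<partial>Q)"
    by (intro nn_integral_cong; simp)+
  then show ?thesis
    unfolding dual_def extended_integral_completion by (simp add: extended_integral_def)
qed

end

subsection \<open>Products\<close>

text \<open>The multipliers can be chosen separately, so the joint infimum is governed by the infima
  \<open>v k\<close>. \<open>below\<close> keeps these off \<open>-\<infinity>\<close>, and
  \<open>lower\<close> forces them to be finite once \<open>S\<close> is, so that the rest is real
  arithmetic.\<close>

lemma INF_sum_eqI:
  fixes G :: "'i \<Rightarrow> real \<Rightarrow> ereal" and S :: ereal
  assumes fin: "finite I"
    and below: "\<And>k l. k \<in> I \<Longrightarrow> 0 \<le> l \<Longrightarrow> ereal (a k) < G k l"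
    and upper: "\<And>l. (\<And>k. k \<in> I \<Longrightarrow> 0 \<le> l k) \<Longrightarrow> S \<le> (\<Sum>k\<in>I. G k (l k))"
    and lower: "\<And>r. (\<And>k l. k \<in> I \<Longrightarrow> 0 \<le> l \<Longrightarrow> ereal (r k) < G k l) \<Longrightarrow> ereal (\<Sum>k\<in>I. r k) \<le> S"
  shows "S = (INF l \<in> {l. \<forall>k\<in>I. 0 \<le> l k}. \<Sum>k\<in>I. G k (l k))"
proof (rule antisym)
  show "S \<le> (INF l \<in> {l. \<forall>k\<in>I. 0 \<le> l k}. \<Sum>k\<in>I. G k (l k))"
    using upper by (intro INF_greatest) auto
  let ?R = "INF l \<in> {l. \<forall>k\<in>I. 0 \<le> l k}. \<Sum>k\<in>I. G k (l k)"
  show "?R \<le> S"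
  proof (cases S)
    case (real s)
    define v where "v k = (INF l\<in>{0..}. G k l)" for k
    have a_le: "ereal (a k) \<le> v k" if "k \<in> I" for k
      unfolding v_def using below[OF that] by (intro INF_greatest) (auto intro: less_imp_le)
    have v_fin: "v k \<noteq> \<infinity>" if k: "k \<in> I" for k
    proof
      assume "v k = \<infinity>"
      then have top: "G k l = \<infinity>" if "0 \<le> l" for l
        using that unfolding v_def by (metis INF_lower atLeast_iff ereal_infty_less_eq(1))
      \<comment> \<open>If \<open>v k\<close> were infinite, any threshold would do at
        \<open>k\<close>; this one makes the total \<open>s + 1\<close>.\<close>
      define R where "R = s - (\<Sum>j\<in>I - {k}. a j) + 1"
      have "ereal (\<Sum>j\<in>I. if j = k then R else a j) \<le> S"
        using below top by (intro lower) auto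
      moreover have "(\<Sum>j\<in>I. if j = k then R else a j) = R + (\<Sum>j\<in>I - {k}. a j)"
        using fin k by (subst sum.remove[of I k]) (auto intro!: sum.cong)
      ultimately show False using real by (simp add: R_def)
    qed
    define w where "w k = real_of_ereal (v k)" for k
    have w: "v k = ereal (w k)" if "k \<in> I" for k
      using a_le[OF that] v_fin[OF that] by (cases "v k") (auto simp: w_def)
    have "?R \<le> ereal (s + e)" if e: "0 < e" for e
    proof -
      \<comment> \<open>Each index loses \<open>d\<close> from above and \<open>d\<close> from
        below, in total at most \<open>e\<close>; the \<open>+ 1\<close> covers empty
        \<open>I\<close>.\<close>
      define d where "d = e / (2 * (real (card I) + 1))"
      have d: "0 < d" using e by (simp add: d_def)
      have "\<exists>l\<ge>0. G k l < ereal (w k + d)" if "k \<in> I" for k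
      proof -
        have "v k < ereal (w k + d)" using w[OF that] d by simp
        then show ?thesis unfolding v_def INF_less_iff by auto
      qed
      then obtain l where l: "\<And>k. k \<in> I \<Longrightarrow> 0 \<le> l k" "\<And>k. k \<in> I \<Longrightarrow> G k (l k) < ereal (w k + d)"
        by metis
      have "ereal (w k - d) < G k x" if "k \<in> I" "0 \<le> x" for k x
      proof -
        have "ereal (w k - d) < v k" using w that d by simp
        also have "\<dots> \<le> G k x" unfolding v_def using that by (intro INF_lower) auto
        finally show ?thesis .
      qed
      then have "(\<Sum>k\<in>I. w k - d) \<le> s"
        using lower[of "\<lambda>k. w k - d"] real by simp
      moreover have "(\<Sum>k\<in>I. w k + d) = (\<Sum>k\<in>I. w k - d) + 2 * d * card I"
        by (simp add: sum.distrib sum_subtractf)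
      moreover have "2 * d * card I \<le> e"
        using e by (simp add: d_def field_simps)
      ultimately have s: "(\<Sum>k\<in>I. w k + d) \<le> s + e" by linarith
      have "?R \<le> (\<Sum>k\<in>I. G k (l k))"
        using l(1) by (intro INF_lower) auto
      also have "\<dots> \<le> (\<Sum>k\<in>I. ereal (w k + d))"
        using l(2) by (intro sum_mono less_imp_le) auto
      also have "\<dots> \<le> ereal (s + e)" using s by simp
      finally show ?thesis .
    qed
    then show ?thesis
      unfolding real by - (rule ereal_le_epsilon2, simp only: plus_ereal.simps)
  next
    case MInf
    then show ?thesis using lower[OF below] by simp
  qed simp
qed

lemma prod_mono_ereal:
  fixes f g :: "'i \<Rightarrow> ereal"
  assumes "\<And>i. i \<in> I \<Longrightarrow> 0 \<le> f i" "\<And>i. i \<in> I \<Longrightarrow> f i \<le> g i"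
  shows "(\<Prod>i\<in>I. f i) \<le> (\<Prod>i\<in>I. g i)"
  using assms
proof (induction I rule: infinite_finite_induct)
  case (insert i I)
  have "0 \<le> g i" using insert.prems[of i] by (meson insertI1 order_trans)
  moreover have "0 \<le> (\<Prod>i\<in>I. f i)" using insert.prems(1) by (intro prod_ereal_pos) blast
  moreover have "f i \<le> g i" using insert.prems(2) by blast
  moreover have "(\<Prod>i\<in>I. f i) \<le> (\<Prod>i\<in>I. g i)" using insert.prems by (intro insert.IH) blast+
  ultimately show ?case using insert.hyps by (simp add: ereal_mult_mono)
qed auto

lemma enn2ereal_prod: "enn2ereal (\<Prod>i\<in>I. f i) = (\<Prod>i\<in>I. enn2ereal (f i))"
  by (induction I rule: infinite_finite_induct) (auto simp: times_ennreal.rep_eq one_ennreal.rep_eq)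

text \<open>Multiplicative counterpart, with relative slack in place of additive slack. This needs
  strictly positive infima, which explains the dichotomy in \<open>below\<close>: a factor not
  bounded away from \<open>0\<close> vanishes at multiplier \<open>0\<close>.\<close>

lemma INF_prod_eqI:
  fixes G :: "'i \<Rightarrow> real \<Rightarrow> ereal" and S :: ereal
  assumes fin: "finite I"
    and nonneg: "\<And>k l. k \<in> I \<Longrightarrow> 0 \<le> l \<Longrightarrow> 0 \<le> G k l" and "0 \<le> S"
    and below: "\<And>k. k \<in> I \<Longrightarrow> G k 0 = 0 \<or> (\<exists>a>0. \<forall>l\<ge>0. ereal a < G k l)"
    and upper: "\<And>l. (\<And>k. k \<in> I \<Longrightarrow> 0 \<le> l k) \<Longrightarrow> S \<le> (\<Prod>k\<in>I. G k (l k))"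
    and lower: "\<And>r. (\<And>k. k \<in> I \<Longrightarrow> 0 < r k) \<Longrightarrow>
      (\<And>k l. k \<in> I \<Longrightarrow> 0 \<le> l \<Longrightarrow> ereal (r k) < G k l) \<Longrightarrow> ereal (\<Prod>k\<in>I. r k) \<le> S"
  shows "S = (INF l \<in> {l. \<forall>k\<in>I. 0 \<le> l k}. \<Prod>k\<in>I. G k (l k))"
proof (rule antisym)
  show "S \<le> (INF l \<in> {l. \<forall>k\<in>I. 0 \<le> l k}. \<Prod>k\<in>I. G k (l k))"
    using upper by (intro INF_greatest) auto
  let ?R = "INF l \<in> {l. \<forall>k\<in>I. 0 \<le> l k}. \<Prod>k\<in>I. G k (l k)"
  have R_le: "?R \<le> (\<Prod>k\<in>I. G k (l k))" if "\<And>k. k \<in> I \<Longrightarrow> 0 \<le> l k" for l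
    using that by (intro INF_lower) auto
  show "?R \<le> S"
  proof (cases "\<exists>k\<in>I. G k 0 = 0")
    case True
    then have "(\<Prod>k\<in>I. G k 0) = 0" using fin by (auto simp: prod_ereal_0)
    then show ?thesis using R_le[of "\<lambda>_. 0"] \<open>0 \<le> S\<close> by simp
  next
    case False
    with below obtain a where a: "\<And>k. k \<in> I \<Longrightarrow> 0 < a k"
      "\<And>k l. k \<in> I \<Longrightarrow> 0 \<le> l \<Longrightarrow> ereal (a k) < G k l"
      by metis
    show ?thesis
    proof (cases S)
      case (real s)
      define v where "v k = (INF l\<in>{0..}. G k l)" for k
      have a_le: "ereal (a k) \<le> v k" if "k \<in> I" for k
        unfolding v_def using a(2)[OF that] by (intro INF_greatest) (auto intro: less_imp_le)
      have v_fin: "v k \<noteq> \<infinity>" if k: "k \<in> I" for k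
      proof
        assume "v k = \<infinity>"
        then have top: "G k l = \<infinity>" if "0 \<le> l" for l
          using that unfolding v_def by (metis INF_lower atLeast_iff ereal_infty_less_eq(1))
        define c where "c = (\<Prod>j\<in>I - {k}. a j)"
        have c: "0 < c" unfolding c_def using a by (intro prod_pos) auto
        \<comment> \<open>Chosen so that the product of the thresholds is \<open>s + 1\<close>,
          contradicting the finite value \<open>s\<close>.\<close>
        define R where "R = (s + 1) / c"
        have "0 < R" using c real \<open>0 \<le> S\<close> by (simp add: R_def)
        then have "ereal (\<Prod>j\<in>I. if j = k then R else a j) \<le> S"
          using a top by (intro lower) auto
        moreover have "(\<Prod>j\<in>I. if j = k then R else a j) = R * c"
          unfolding c_def using fin k by (subst prod.remove[of I k]) (auto intro!: prod.cong)
        ultimately show False using real c by (simp add: R_def)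
      qed
      define w where "w k = real_of_ereal (v k)" for k
      have w: "v k = ereal (w k)" if "k \<in> I" for k
        using a_le[OF that] v_fin[OF that] by (cases "v k") (auto simp: w_def)
      have w_pos: "0 < w k" if "k \<in> I" for k
        using a_le[OF that] a(1)[OF that] w[OF that] by simp
      let ?N = "card I"
      \<comment> \<open>Each factor contributes \<open>t\<close> twice: multipliers are chosen with
        value below \<open>w k / t\<close>, and \<open>lower\<close> is applied to
        \<open>t * w k\<close>.\<close>
      have le: "?R \<le> ereal (s / t ^ (2 * ?N))" if t: "0 < t" "t < 1" for t
      proof -
        have "\<exists>l\<ge>0. G k l < ereal (w k / t)" if "k \<in> I" for k
        proof -
          have "v k < ereal (w k / t)" using w[OF that] w_pos[OF that] t by (simp add: field_simps)
          then show ?thesis unfolding v_def INF_less_iff by auto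
        qed
        then obtain l where l: "\<And>k. k \<in> I \<Longrightarrow> 0 \<le> l k" "\<And>k. k \<in> I \<Longrightarrow> G k (l k) < ereal (w k / t)"
          by metis
        have "ereal (t * w k) < G k x" if "k \<in> I" "0 \<le> x" for k x
        proof -
          have "ereal (t * w k) < v k" using w[OF that(1)] w_pos[OF that(1)] t by simp
          also have "\<dots> \<le> G k x" unfolding v_def using that by (intro INF_lower) auto
          finally show ?thesis .
        qed
        then have "(\<Prod>k\<in>I. t * w k) \<le> s"
          using lower[of "\<lambda>k. t * w k"] real w_pos t by simp
        then have "t ^ ?N * (\<Prod>k\<in>I. w k) \<le> s"
          by (simp add: prod.distrib)
        moreover have "t ^ ?N * (\<Prod>k\<in>I. w k / t) = (\<Prod>k\<in>I. w k)"
          using t by (simp add: prod_dividef)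
        ultimately have "t ^ ?N * (t ^ ?N * (\<Prod>k\<in>I. w k / t)) \<le> s" by simp
        then have "(\<Prod>k\<in>I. w k / t) * t ^ (2 * ?N) \<le> s"
          unfolding mult_2 power_add by (simp only: ac_simps)
        then have s: "(\<Prod>k\<in>I. w k / t) \<le> s / t ^ (2 * ?N)"
          using t by (subst pos_le_divide_eq) auto
        have "?R \<le> (\<Prod>k\<in>I. G k (l k))" using l(1) by (rule R_le)
        also have "\<dots> \<le> (\<Prod>k\<in>I. ereal (w k / t))"
          using l nonneg by (intro prod_mono_ereal) (auto intro: less_imp_le)
        also have "\<dots> \<le> ereal (s / t ^ (2 * ?N))" using s by (simp add: prod_ereal)
        finally show ?thesis .
      qed
      have "((\<lambda>t. s / t ^ (2 * ?N)) \<longlongrightarrow> s / 1 ^ (2 * ?N)) (at_left (1::real))"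
        by (intro tendsto_intros) auto
      then have "((\<lambda>t. ereal (s / t ^ (2 * ?N))) \<longlongrightarrow> ereal s) (at_left (1::real))"
        by (intro tendsto_ereal) simp
      moreover have "eventually (\<lambda>t. ?R \<le> ereal (s / t ^ (2 * ?N))) (at_left (1::real))"
        using eventually_at_left_real[of 0 "1::real"] by (auto elim!: eventually_mono intro: le)
      ultimately show ?thesis
        unfolding real by (intro tendsto_lowerbound) auto
    next
      case MInf
      then show ?thesis using lower[of a] a by auto
    qed simp
  qed
qed

section \<open>Integration against product measures\<close>

lemma PiM_component:
  fixes f :: "'a \<Rightarrow> real"
  assumes P: "\<And>i. i \<in> I \<Longrightarrow> prob_space (P i)" and i: "i \<in> I"
  shows "f \<in> borel_measurable (P i) \<Longrightarrow> integrable (PiM I P) (\<lambda>x. f (x i)) \<longleftrightarrow> integrable (P i) f"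
    and "f \<in> borel_measurable (P i) \<Longrightarrow> (\<integral>x. f (x i) \<partial>PiM I P) = integral\<^sup>L (P i) f"
proof -
  have m: "(\<lambda>x. x i) \<in> PiM I P \<rightarrow>\<^sub>M P i" using i by measurable
  have d: "distr (PiM I P) (P i) (\<lambda>x. x i) = P i"
    using P i by (rule distr_PiM_component)
  show "f \<in> borel_measurable (P i) \<Longrightarrow> integrable (PiM I P) (\<lambda>x. f (x i)) \<longleftrightarrow> integrable (P i) f"
    using integrable_distr_eq[OF m, of f] by (simp add: d)
  show "f \<in> borel_measurable (P i) \<Longrightarrow> (\<integral>x. f (x i) \<partial>PiM I P) = integral\<^sup>L (P i) f"
    using integral_distr[OF m, of f] by (simp add: d)
qed

lemma PiM_nn_integral_prod:
  assumes I: "finite I" and P: "\<And>i. i \<in> I \<Longrightarrow> prob_space (P i)"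
    and f: "\<And>i. i \<in> I \<Longrightarrow> f i \<in> borel_measurable (P i)"
  shows "(\<integral>\<^sup>+x. (\<Prod>i\<in>I. f i (x i)) \<partial>PiM I P) = (\<Prod>i\<in>I. integral\<^sup>N (P i) (f i))"
proof -
  \<comment> \<open>The locale \<open>product_sigma_finite\<close> constrains all indices, so the
    family is padded with a point mass outside \<open>I\<close>.\<close>
  define P' where "P' i = (if i \<in> I then P i else return (count_space UNIV) undefined)" for i
  have P': "prob_space (P' i)" for i
    using P by (simp add: P'_def prob_space_return)
  interpret product_sigma_finite P'
    by (intro product_sigma_finite.intro prob_space_imp_sigma_finite P')
  have "PiM I P = PiM I P'" by (rule PiM_cong) (auto simp: P'_def)
  then have "(\<integral>\<^sup>+x. (\<Prod>i\<in>I. f i (x i)) \<partial>PiM I P) = (\<Prod>i\<in>I. integral\<^sup>N (P' i) (f i))"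
    using f by (simp add: product_nn_integral_prod[OF I] P'_def)
  then show ?thesis by (simp add: P'_def)
qed

text \<open>Positive parts are integrable by assumption, so the total has either integral
  \<open>-\<infinity>\<close>, where the bound is trivial, or a finite one. In the finite case
  linearity requires each summand to be integrable, which is derived from the total.\<close>

lemma extended_integral_PiM_sum_le:
  fixes h :: "'i \<Rightarrow> 'a \<Rightarrow> real"
  assumes I: "finite I" and prob: "\<And>i. i \<in> I \<Longrightarrow> prob_space (P i)"
    and h: "\<And>i. i \<in> I \<Longrightarrow> h i \<in> borel_measurable (P i)"
    and pos: "\<And>i. i \<in> I \<Longrightarrow> integrable (P i) (\<lambda>x. max 0 (h i x))"
    and bound: "\<And>i. i \<in> I \<Longrightarrow> integrable (P i) (h i) \<Longrightarrow> ereal (integral\<^sup>L (P i) (h i)) \<le> b i"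
  shows "extended_integral (PiM I P) (\<lambda>\<xi>. ereal (\<Sum>i\<in>I. h i (\<xi> i))) \<le> (\<Sum>i\<in>I. b i)"
proof -
  let ?R = "PiM I P" and ?h = "\<lambda>\<xi>. \<Sum>i\<in>I. h i (\<xi> i)" and ?p = "\<lambda>\<xi>. \<Sum>i\<in>I. max 0 (h i (\<xi> i))"
  have comp: "integrable ?R (\<lambda>\<xi>. f (\<xi> i)) \<longleftrightarrow> integrable (P i) f"
    "(\<integral>\<xi>. f (\<xi> i) \<partial>?R) = integral\<^sup>L (P i) f"
    if "i \<in> I" "f \<in> borel_measurable (P i)" for i and f :: "'a \<Rightarrow> real"
    using PiM_component[of I P i f] prob that by blast+
  have p_int: "integrable ?R ?p"
    using pos h by (intro Bochner_Integration.integrable_sum) (simp add: comp(1)[of _ "\<lambda>x. max 0 (h _ x)"])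
  have p_nonneg: "0 \<le> ?p \<xi>" for \<xi> by (intro sum_nonneg) auto
  have h_comp: "(\<lambda>\<xi>. h i (\<xi> i)) \<in> borel_measurable ?R" if "i \<in> I" for i
    using measurable_compose[OF measurable_component_singleton[OF that, of P] h[OF that]] .
  then have h_R: "?h \<in> borel_measurable ?R" by (intro borel_measurable_sum)
  have top: "(\<integral>\<^sup>+\<xi>. ennreal (?h \<xi>) \<partial>?R) \<noteq> \<infinity>"
  proof -
    have "(\<integral>\<^sup>+\<xi>. ennreal (?h \<xi>) \<partial>?R) \<le> (\<integral>\<^sup>+\<xi>. ennreal (?p \<xi>) \<partial>?R)"
      by (intro nn_integral_mono ennreal_leI sum_mono) auto
    also have "\<dots> = ennreal (integral\<^sup>L ?R ?p)"
      using p_nonneg by (intro nn_integral_eq_integral[OF p_int] AE_I2)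
    finally show ?thesis by (auto simp: top_unique)
  qed
  show ?thesis
  proof (cases "(\<integral>\<^sup>+\<xi>. ennreal (- ?h \<xi>) \<partial>?R) = \<infinity>")
    case True
    then have "extended_integral ?R (\<lambda>x. ereal (?h x)) = -\<infinity>"
      using top by (cases "\<integral>\<^sup>+\<xi>. ennreal (?h \<xi>) \<partial>?R") (auto simp: extended_integral_def)
    then show ?thesis by simp
  next
    case False
    then have h_int: "integrable ?R ?h"
      using top h_R by (simp add: real_integrable_def)
    have int: "integrable (P i) (h i)" if i: "i \<in> I" for i
    proof -
      have "integrable ?R (\<lambda>\<xi>. h i (\<xi> i))"
      proof (rule Bochner_Integration.integrable_bound)
        \<comment> \<open>A very negative summand is either visible in the total or offset by
          positive parts of the others, so this function dominates it.\<close>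
        show "integrable ?R (\<lambda>\<xi>. \<bar>?h \<xi>\<bar> + ?p \<xi>)"
          by (rule Bochner_Integration.integrable_add[OF integrable_abs[OF h_int] p_int])
        show "(\<lambda>\<xi>. h i (\<xi> i)) \<in> borel_measurable ?R" by (rule h_comp[OF i])
        show "AE \<xi> in ?R. norm (h i (\<xi> i)) \<le> norm (\<bar>?h \<xi>\<bar> + ?p \<xi>)"
        proof (rule AE_I2)
          fix \<xi>
          have "?h \<xi> = h i (\<xi> i) + (\<Sum>j\<in>I - {i}. h j (\<xi> j))"
            using i I by (intro sum.remove) auto
          moreover have "?p \<xi> = max 0 (h i (\<xi> i)) + (\<Sum>j\<in>I - {i}. max 0 (h j (\<xi> j)))"
            using i I by (intro sum.remove) auto
          moreover have "(\<Sum>j\<in>I - {i}. h j (\<xi> j)) \<le> (\<Sum>j\<in>I - {i}. max 0 (h j (\<xi> j)))"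
            by (intro sum_mono) auto
          moreover have "0 \<le> (\<Sum>j\<in>I - {i}. max 0 (h j (\<xi> j)))"
            by (intro sum_nonneg) auto
          ultimately show "norm (h i (\<xi> i)) \<le> norm (\<bar>?h \<xi>\<bar> + ?p \<xi>)"
            unfolding real_norm_def by linarith
        qed
      qed
      then show ?thesis using comp(1)[OF i h[OF i]] by simp
    qed
    have "extended_integral ?R (\<lambda>x. ereal (?h x)) = ereal (\<integral>\<xi>. ?h \<xi> \<partial>?R)"
      by (rule extended_integral_ereal[OF h_int])
    also have "(\<integral>\<xi>. ?h \<xi> \<partial>?R) = (\<Sum>i\<in>I. \<integral>\<xi>. h i (\<xi> i) \<partial>?R)"
      using int comp(1) h by (intro Bochner_Integration.integral_sum) blast
    also have "\<dots> = (\<Sum>i\<in>I. integral\<^sup>L (P i) (h i))"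
      using comp(2) h by (intro sum.cong) auto
    also have "ereal \<dots> = (\<Sum>i\<in>I. ereal (integral\<^sup>L (P i) (h i)))" by simp
    also have "\<dots> \<le> (\<Sum>i\<in>I. b i)"
      using bound int by (intro sum_mono) blast
    finally show ?thesis .
  qed
qed

section \<open>Assembly of the factors\<close>

lemma product_duality:
  fixes X :: "'i \<Rightarrow> 'a metric" and h :: "'i \<Rightarrow> 'a \<Rightarrow> real"
  assumes fin_I: "finite I"
    and loc: "\<And>k. k \<in> I \<Longrightarrow> wasserstein_duality (X k) p (\<epsilon> k) (Q k) (h k)"
  defines "\<H> \<equiv> {PiM I P |P. \<forall>k\<in>I. P k \<in> wasserstein_ball p (X k) (Q k) (\<epsilon> k)}"
  shows "worst_case_expectation \<H> (\<lambda>\<xi>. \<Sum>k\<in>I. h k (\<xi> k)) =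
      (INF l \<in> {l. \<forall>k\<in>I. 0 \<le> l k}.
        \<Sum>k\<in>I. wasserstein_duality.dual (X k) p (\<epsilon> k) (Q k) (h k) (l k))"
    and "\<forall>k\<in>I. \<forall>\<xi>\<in>mspace (X k). 0 \<le> h k \<xi> \<Longrightarrow>
      worst_case_expectation \<H> (\<lambda>\<xi>. \<Prod>k\<in>I. h k (\<xi> k)) =
      (INF l \<in> {l. \<forall>k\<in>I. 0 \<le> l k}.
        \<Prod>k\<in>I. wasserstein_duality.dual (X k) p (\<epsilon> k) (Q k) (h k) (l k))"
proof -
  let ?ball = "\<lambda>k. wasserstein_ball p (X k) (Q k) (\<epsilon> k)"
  let ?G = "\<lambda>k. wasserstein_duality.dual (X k) p (\<epsilon> k) (Q k) (h k)"
  have self: "ereal (integral\<^sup>L (Q k) (h k)) \<le> ?G k l" if "k \<in> I" "0 \<le> l" for k l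
  proof -
    have "ereal (integral\<^sup>L (Q k) (h k)) \<le> ereal (integral\<^sup>L (Q k) (h k) + l * \<epsilon> k powr p)"
      using that by simp
    also have "\<dots> \<le> ?G k l" by (rule wasserstein_duality.dual_ge_self[OF loc[OF that(1)]])
    finally show ?thesis .
  qed
  have ball: "prob_space P" "sets P = sets (borel_metric (X k))" "h k \<in> borel_measurable P"
    "space P = mspace (X k)" if "k \<in> I" "P \<in> ?ball k" for k P
  proof -
    show 1: "prob_space P" "sets P = sets (borel_metric (X k))"
      using that by (auto simp: wasserstein_ball_def prob_measures_def)
    show "h k \<in> borel_measurable P"
      using wasserstein_duality.h_measurable[OF loc[OF that(1)]] measurable_cong_sets[OF 1(2) refl] by blast
    show "space P = mspace (X k)" using sets_eq_imp_space_eq[OF 1(2)] by simp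
  qed
  \<comment> \<open>The hyperrectangle constrains the factors independently, so near-optimal
    measures can be chosen index by index.\<close>
  have near: "\<exists>P. \<forall>k\<in>I. P k \<in> ?ball k \<and> integrable (P k) (h k) \<and> r k < integral\<^sup>L (P k) (h k)"
    if "\<And>k l. k \<in> I \<Longrightarrow> 0 \<le> l \<Longrightarrow> ereal (r k) < ?G k l" for r
  proof (rule bchoice, rule ballI)
    fix k assume k: "k \<in> I"
    have "\<exists>P\<in>?ball k. integrable P (h k) \<and> r k < integral\<^sup>L P (h k)"
      using that[OF k] by (rule wasserstein_duality.strong_duality[OF loc[OF k]])
    then show "\<exists>P. P \<in> ?ball k \<and> integrable P (h k) \<and> r k < integral\<^sup>L P (h k)" by blast
  qed
  have in_H: "PiM I P \<in> \<H>" if "\<forall>k\<in>I. P k \<in> ?ball k" for P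
    using that unfolding \<H>_def by blast
  have comp: "(\<lambda>\<xi>. h k (\<xi> k)) \<in> borel_measurable (PiM I P)"
    if "\<forall>k\<in>I. P k \<in> ?ball k" "k \<in> I" for P k
    using measurable_compose[OF measurable_component_singleton[OF that(2), of P] ball(3)[OF that(2)]] that by auto
  have component: "integrable (PiM I P) (\<lambda>\<xi>. f (\<xi> k)) \<longleftrightarrow> integrable (P k) f"
    "(\<integral>\<xi>. f (\<xi> k) \<partial>PiM I P) = integral\<^sup>L (P k) f"
    if "\<forall>k\<in>I. P k \<in> ?ball k" "k \<in> I" "f \<in> borel_measurable (P k)"
    for P k and f :: "'a \<Rightarrow> real"
  proof -
    have prob: "prob_space (P i)" if "i \<in> I" for i
      using ball(1) \<open>\<forall>k\<in>I. P k \<in> ?ball k\<close> that by blast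
    show "integrable (PiM I P) (\<lambda>\<xi>. f (\<xi> k)) \<longleftrightarrow> integrable (P k) f"
      "(\<integral>\<xi>. f (\<xi> k) \<partial>PiM I P) = integral\<^sup>L (P k) f"
      using PiM_component[of I P k f] prob that by blast+
  qed
  show "worst_case_expectation \<H> (\<lambda>\<xi>. \<Sum>k\<in>I. h k (\<xi> k)) =
      (INF l \<in> {l. \<forall>k\<in>I. 0 \<le> l k}. \<Sum>k\<in>I. ?G k (l k))"
  proof (rule INF_sum_eqI[OF fin_I])
    \<comment> \<open>Subtracting \<open>1\<close> makes the bound \<open>self\<close>
      strict.\<close>
    show "ereal (integral\<^sup>L (Q k) (h k) - 1) < ?G k l" if "k \<in> I" "0 \<le> l" for k l
      using self[OF that] by (rule less_le_trans[rotated]) simp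
  next
    fix l :: "'i \<Rightarrow> real" assume l: "\<And>k. k \<in> I \<Longrightarrow> 0 \<le> l k"
    show "worst_case_expectation \<H> (\<lambda>\<xi>. \<Sum>k\<in>I. h k (\<xi> k)) \<le> (\<Sum>k\<in>I. ?G k (l k))"
      unfolding worst_case_expectation_def
    proof (rule SUP_least, clarify)
      fix R assume R: "R \<in> \<H>"
      obtain P where P: "\<forall>k\<in>I. P k \<in> ?ball k" and R_eq: "R = PiM I P"
        using R unfolding \<H>_def by blast
      let ?h = "\<lambda>\<xi>. \<Sum>k\<in>I. h k (\<xi> k)"
      show "extended_integral R (\<lambda>x. ereal (?h x)) \<le> (\<Sum>k\<in>I. ?G k (l k))"
      \<comment> \<open>One infinite dual value makes the whole sum infinite; otherwise weak duality
        is available for all factors at once.\<close>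
      proof (cases "\<exists>k\<in>I. ?G k (l k) = \<infinity>")
        case True
        then have "(\<Sum>k\<in>I. ?G k (l k)) = \<infinity>" using fin_I by (auto simp: sum_Pinfty)
        then show ?thesis by simp
      next
        case False
        then have fin: "?G k (l k) < \<infinity>" if "k \<in> I" for k using that by auto
        show ?thesis
          unfolding R_eq
        proof (rule extended_integral_PiM_sum_le)
          fix k assume k: "k \<in> I"
          have Pk: "P k \<in> ?ball k" using P k by blast
          show "prob_space (P k)" "h k \<in> borel_measurable (P k)" using ball[OF k Pk] by blast+
          show "integrable (P k) (\<lambda>x. max 0 (h k x))"
            by (rule wasserstein_duality.weak_duality(1)[OF loc[OF k] l[OF k] Pk fin[OF k]])
          show "ereal (integral\<^sup>L (P k) (h k)) \<le> ?G k (l k)" if "integrable (P k) (h k)"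
            by (rule wasserstein_duality.weak_duality(2)[OF loc[OF k] l[OF k] Pk fin[OF k] that])
        qed (rule fin_I)
      qed
    qed
  next
    fix r assume r: "\<And>k l. k \<in> I \<Longrightarrow> 0 \<le> l \<Longrightarrow> ereal (r k) < ?G k l"
    obtain P where P: "\<forall>k\<in>I. P k \<in> ?ball k \<and> integrable (P k) (h k) \<and> r k < integral\<^sup>L (P k) (h k)"
      using near[OF r] by blast
    let ?h = "\<lambda>\<xi>. \<Sum>k\<in>I. h k (\<xi> k)" and ?R = "PiM I P"
    have P_ball: "\<forall>k\<in>I. P k \<in> ?ball k" using P by blast
    have comp_int: "integrable ?R (\<lambda>\<xi>. h k (\<xi> k))"
      "(\<integral>\<xi>. h k (\<xi> k) \<partial>?R) = integral\<^sup>L (P k) (h k)" if k: "k \<in> I" for k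
      using component[OF P_ball k, of "h k"] P k ball(3)[OF k] by auto
    then have h_int: "integrable ?R ?h" by auto
    have "ereal (\<Sum>k\<in>I. r k) \<le> ereal (\<Sum>k\<in>I. integral\<^sup>L (P k) (h k))"
      unfolding ereal_less_eq using P by (intro sum_mono) (auto intro: less_imp_le)
    also have "\<dots> = extended_integral ?R (\<lambda>x. ereal (?h x))"
      unfolding extended_integral_ereal[OF h_int] using comp_int by simp
    also have "\<dots> \<le> worst_case_expectation \<H> ?h"
      unfolding worst_case_expectation_def
    proof (rule SUP_upper, safe)
      show "?R \<in> \<H>" using in_H P by blast
      show "integral_well_defined ?R (\<lambda>x. ereal (?h x))"
        using h_int by (auto simp: integral_well_defined_def real_integrable_def less_top)
    qed
    finally show "ereal (\<Sum>k\<in>I. r k) \<le> worst_case_expectation \<H> ?h" .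
  qed
  show "worst_case_expectation \<H> (\<lambda>\<xi>. \<Prod>k\<in>I. h k (\<xi> k)) =
      (INF l \<in> {l. \<forall>k\<in>I. 0 \<le> l k}. \<Prod>k\<in>I. ?G k (l k))"
    if nonneg: "\<forall>k\<in>I. \<forall>\<xi>\<in>mspace (X k). 0 \<le> h k \<xi>"
  proof -
    let ?h = "\<lambda>\<xi>. \<Prod>k\<in>I. h k (\<xi> k)"
    \<comment> \<open>Nonnegativity makes every integral well defined, and Tonelli factorises it
      without any integrability, infinite factors included.\<close>
    have PiM: "integral_well_defined (PiM I P) (\<lambda>x. ereal (?h x))"
      "extended_integral (PiM I P) (\<lambda>x. ereal (?h x)) =
        (\<Prod>k\<in>I. enn2ereal (\<integral>\<^sup>+x. ennreal (h k x) \<partial>P k))"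
      if P: "\<forall>k\<in>I. P k \<in> ?ball k" for P
    proof -
      have prob: "prob_space (P k)" if "k \<in> I" for k using ball(1) P that by blast
      have mem: "0 \<le> h k (\<xi> k)" if "\<xi> \<in> space (PiM I P)" "k \<in> I" for \<xi> k
        using that nonneg ball(4)[OF that(2)] P by (auto simp: space_PiM PiE_iff)
      have "(\<integral>\<^sup>+\<xi>. ennreal (- ?h \<xi>) \<partial>PiM I P) = (\<integral>\<^sup>+\<xi>. 0 \<partial>PiM I P)"
        using mem by (intro nn_integral_cong) (auto intro!: ennreal_neg prod_nonneg)
      then have neg: "(\<integral>\<^sup>+\<xi>. ennreal (- ?h \<xi>) \<partial>PiM I P) = 0" by simp
      have "(\<lambda>x. ?h x) \<in> borel_measurable (PiM I P)"
        using comp[OF P] by (intro borel_measurable_prod) auto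
      then show "integral_well_defined (PiM I P) (\<lambda>x. ereal (?h x))"
        using neg by (simp add: integral_well_defined_def)
      have "(\<integral>\<^sup>+\<xi>. ennreal (?h \<xi>) \<partial>PiM I P) = (\<integral>\<^sup>+\<xi>. (\<Prod>k\<in>I. ennreal (h k (\<xi> k))) \<partial>PiM I P)"
        using mem by (intro nn_integral_cong) (auto simp: prod_ennreal)
      also have "\<dots> = (\<Prod>k\<in>I. \<integral>\<^sup>+x. ennreal (h k x) \<partial>P k)"
        using prob ball(3) P by (intro PiM_nn_integral_prod[OF fin_I]) auto
      finally show "extended_integral (PiM I P) (\<lambda>x. ereal (?h x)) =
          (\<Prod>k\<in>I. enn2ereal (\<integral>\<^sup>+x. ennreal (h k x) \<partial>P k))"
        using neg by (simp add: extended_integral_def enn2ereal_prod zero_ennreal.rep_eq)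
    qed
    have lower: "(\<Prod>k\<in>I. enn2ereal (\<integral>\<^sup>+x. ennreal (h k x) \<partial>P k)) \<le> worst_case_expectation \<H> ?h"
      if P: "\<forall>k\<in>I. P k \<in> ?ball k" for P
      unfolding worst_case_expectation_def PiM(2)[OF P, symmetric]
      using in_H[OF P] PiM(1)[OF P] by (intro SUP_upper) auto
    have AE_nonneg: "AE x in P. 0 \<le> h k x" if "k \<in> I" "P \<in> ?ball k" for k P
      using ball(4)[OF that] nonneg that(1) by (intro AE_I2) auto
    show ?thesis
    proof (rule INF_prod_eqI[OF fin_I])
      show "0 \<le> ?G k l" if "k \<in> I" "0 \<le> l" for k l
      proof -
        have "0 \<le> integral\<^sup>L (Q k) (h k)"
          using AE_nonneg[OF that(1) wasserstein_duality.ball_nonempty[OF loc[OF that(1)]]]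
          by (rule integral_nonneg_AE)
        then have "0 \<le> ereal (integral\<^sup>L (Q k) (h k))" by simp
        then show ?thesis using self[OF that] by (rule order_trans)
      qed
      have "0 \<le> (\<Prod>k\<in>I. enn2ereal (\<integral>\<^sup>+x. ennreal (h k x) \<partial>Q k))"
        by (rule prod_ereal_pos) simp
      also have "\<dots> \<le> worst_case_expectation \<H> ?h"
        by (intro lower ballI wasserstein_duality.ball_nonempty[OF loc])
      finally show "0 \<le> worst_case_expectation \<H> ?h" .
    next
      fix k assume k: "k \<in> I"
      show "?G k 0 = 0 \<or> (\<exists>a>0. \<forall>l\<ge>0. ereal a < ?G k l)"
      proof (cases "\<exists>x\<in>mspace (X k). 0 < h k x")
        case True
        then obtain x where x: "x \<in> mspace (X k)" "0 < h k x" by blast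
        show ?thesis
          by (intro disjI2 wasserstein_duality.dual_bounded_away_from_0[OF loc[OF k] _ x])
            (rule nonneg[rule_format, OF k])
      next
        case False
        then have "h k x = 0" if "x \<in> mspace (X k)" for x
          using nonneg[rule_format, OF k that] that by force
        then show ?thesis
          by (intro disjI1 wasserstein_duality.dual_0_eq_0[OF loc[OF k]])
      qed
    next
      fix l :: "'i \<Rightarrow> real" assume l: "\<And>k. k \<in> I \<Longrightarrow> 0 \<le> l k"
      show "worst_case_expectation \<H> ?h \<le> (\<Prod>k\<in>I. ?G k (l k))"
        unfolding worst_case_expectation_def
      proof (rule SUP_least, clarify)
        fix R assume "R \<in> \<H>"
        then obtain P where P: "\<forall>k\<in>I. P k \<in> ?ball k" and R_eq: "R = PiM I P"
          unfolding \<H>_def by blast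
        show "extended_integral R (\<lambda>x. ereal (?h x)) \<le> (\<Prod>k\<in>I. ?G k (l k))"
          unfolding R_eq PiM(2)[OF P]
        proof (rule prod_mono_ereal)
          fix k assume k: "k \<in> I"
          have Pk: "P k \<in> ?ball k" using P k by blast
          show "enn2ereal (\<integral>\<^sup>+x. ennreal (h k x) \<partial>P k) \<le> ?G k (l k)"
          \<comment> \<open>Unlike for sums, the comparison is made factor by factor, so an infinite
            dual value only trivialises its own factor and a vanishing factor elsewhere remains
            effective.\<close>
          proof (cases "?G k (l k) = \<infinity>")
            case False
            then have fin: "?G k (l k) < \<infinity>" by simp
            have "integrable (P k) (\<lambda>x. max 0 (h k x))"
              by (rule wasserstein_duality.weak_duality(1)[OF loc[OF k] l[OF k] Pk fin])
            then have int: "integrable (P k) (h k)"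
            proof (rule integrable_cong_AE_imp)
              show "AE x in P k. max 0 (h k x) = h k x"
                using AE_nonneg[OF k Pk] by eventually_elim simp
            qed (rule ball(3)[OF k Pk])
            have "enn2ereal (\<integral>\<^sup>+x. ennreal (h k x) \<partial>P k) = ereal (integral\<^sup>L (P k) (h k))"
              using AE_nonneg[OF k Pk]
              by (simp add: nn_integral_eq_integral[OF int] enn2ereal_ennreal integral_nonneg_AE)
            also have "\<dots> \<le> ?G k (l k)"
              by (rule wasserstein_duality.weak_duality(2)[OF loc[OF k] l[OF k] Pk fin int])
            finally show ?thesis .
          qed simp
        qed simp
      qed
    next
      fix r assume r_pos: "\<And>k. k \<in> I \<Longrightarrow> 0 < r k"
        and r: "\<And>k l. k \<in> I \<Longrightarrow> 0 \<le> l \<Longrightarrow> ereal (r k) < ?G k l"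
      obtain P where P: "\<forall>k\<in>I. P k \<in> ?ball k \<and> integrable (P k) (h k) \<and> r k < integral\<^sup>L (P k) (h k)"
        using near[OF r] by blast
      have "ereal (\<Prod>k\<in>I. r k) = (\<Prod>k\<in>I. ereal (r k))" by (simp add: prod_ereal)
      also have "\<dots> \<le> (\<Prod>k\<in>I. enn2ereal (\<integral>\<^sup>+x. ennreal (h k x) \<partial>P k))"
      proof (rule prod_mono_ereal)
        fix k assume k: "k \<in> I"
        then have Pk: "P k \<in> ?ball k" and int: "integrable (P k) (h k)" and rk: "r k < integral\<^sup>L (P k) (h k)"
          using P by auto
        show "0 \<le> ereal (r k)" using r_pos[OF k] by simp
        have "enn2ereal (\<integral>\<^sup>+x. ennreal (h k x) \<partial>P k) = ereal (integral\<^sup>L (P k) (h k))"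
          using AE_nonneg[OF k Pk]
          by (simp add: nn_integral_eq_integral[OF int] enn2ereal_ennreal integral_nonneg_AE)
        then show "ereal (r k) \<le> enn2ereal (\<integral>\<^sup>+x. ennreal (h k x) \<partial>P k)" using rk by simp
      qed
      also have "\<dots> \<le> worst_case_expectation \<H> ?h" using P by (intro lower) blast
      finally show "ereal (\<Prod>k\<in>I. r k) \<le> worst_case_expectation \<H> ?h" .
    qed
  qed
qed

theorem proposition6p2:
  fixes n :: nat and p :: real
    and X :: "nat \<Rightarrow> 'a metric"
    and Q :: "nat \<Rightarrow> 'a measure"
    and \<epsilon> :: "nat \<Rightarrow> real"
    and h :: "nat \<Rightarrow> 'a \<Rightarrow> real"
  assumes "n \<ge> 1" and "p \<ge> 1"
    and "\<And>k. k \<in> {1..n} \<Longrightarrow> polish_metric (X k)"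
    and "\<And>k. k \<in> {1..n} \<Longrightarrow> Q k \<in> prob_measures p (X k)"
    and "\<And>k. k \<in> {1..n} \<Longrightarrow> \<epsilon> k > 0"
    and "\<And>k. k \<in> {1..n} \<Longrightarrow> usc_on_metric (X k) (h k)"
    and "\<And>k. k \<in> {1..n} \<Longrightarrow> integrable (Q k) (h k)"
  shows
    "worst_case_expectation (wasserstein_hyperrectangle n p X Q \<epsilon>) (\<lambda>\<xi>. \<Sum>k\<in>{1..n}. h k (\<xi> k)) =
       (INF l \<in> {l :: nat \<Rightarrow> real. \<forall>k\<in>{1..n}. 0 \<le> l k}.
          \<Sum>k\<in>{1..n}. extended_integral (completion (Q k))
            (\<lambda>\<zeta>. SUP \<xi> \<in> mspace (X k).
               ereal (h k \<xi> + l k * (\<epsilon> k powr p - mdist (X k) \<zeta> \<xi> powr p))))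
     \<and>
     ((\<forall>k\<in>{1..n}. \<forall>\<xi>\<in>mspace (X k). 0 \<le> h k \<xi>) \<longrightarrow>
     worst_case_expectation (wasserstein_hyperrectangle n p X Q \<epsilon>) (\<lambda>\<xi>. \<Prod>k\<in>{1..n}. h k (\<xi> k)) =
       (INF l \<in> {l :: nat \<Rightarrow> real. \<forall>k\<in>{1..n}. 0 \<le> l k}.
          \<Prod>k\<in>{1..n}. extended_integral (completion (Q k))
            (\<lambda>\<zeta>. SUP \<xi> \<in> mspace (X k).
               ereal (h k \<xi> + l k * (\<epsilon> k powr p - mdist (X k) \<zeta> \<xi> powr p)))))"
proof -
  have loc: "wasserstein_duality (X k) p (\<epsilon> k) (Q k) (h k)" if "k \<in> {1..n}" for k
    using assms that by unfold_locales (auto simp: polish_metric_def)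
  have dual: "extended_integral (completion (Q k)) (\<lambda>\<zeta>. SUP \<xi> \<in> mspace (X k).
      ereal (h k \<xi> + l * (\<epsilon> k powr p - mdist (X k) \<zeta> \<xi> powr p))) =
      wasserstein_duality.dual (X k) p (\<epsilon> k) (Q k) (h k) l" if "k \<in> {1..n}" for k l
  proof -
    interpret wasserstein_duality "X k" p "\<epsilon> k" "Q k" "h k" by (rule loc[OF that])
    show ?thesis by (simp only: dual_def \<psi>_def[abs_def] gain_def c_def)
  qed
  \<comment> \<open>With this index set, the set of product measures in
    \<open>product_duality\<close> is literally the body of
    \<open>wasserstein_hyperrectangle\<close>, so folding the definition identifies the two.\<close>
  note duality = product_duality[where I = "{1..n}" and X = X and p = p and \<epsilon> = \<epsilon> and Q = Q and h = h,
      folded wasserstein_hyperrectangle_def]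
  show ?thesis (is "?a = ?b \<and> (?nonneg \<longrightarrow> ?c = ?d)")
  proof (intro conjI impI)
    have "?a = (INF l \<in> {l. \<forall>k\<in>{1..n}. 0 \<le> l k}.
        \<Sum>k\<in>{1..n}. wasserstein_duality.dual (X k) p (\<epsilon> k) (Q k) (h k) (l k))"
      using loc by (intro duality(1)) auto
    also have "\<dots> = ?b"
      by (intro INF_cong sum.cong refl dual[symmetric])
    finally show "?a = ?b" .
    assume nonneg: ?nonneg
    have "?c = (INF l \<in> {l. \<forall>k\<in>{1..n}. 0 \<le> l k}.
        \<Prod>k\<in>{1..n}. wasserstein_duality.dual (X k) p (\<epsilon> k) (Q k) (h k) (l k))"
      using loc nonneg by (intro duality(2)) auto
    also have "\<dots> = ?d"
      by (intro INF_cong prod.cong refl dual[symmetric])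
    finally show "?c = ?d" .
  qed
qed

end
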